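(* Let $a_n$ denote the number of (isomorphism classes of) rooted weighted bicolored plane trees of total weight $n$, for $n\ge 0$. Then $$f(t)=\sum_{n\ge0}a_nt^n=\frac{1-t-\sqrt{1-6t+5t^2}}{2t}=1+t+3t^2+10t^3+36t^4+137t^5+543t^6+\cdots,$$ the numbers $a_n$ satisfy $a_0=1$, $a_1=1$ and $a_{n+1}=a_n+\sum_{k=0}^n a_ka_{n-k}$ for $n\ge1$, and $$a_n\sim \frac12\sqrt{\frac5\pi}\,5^n\,n^{-3/2}\qquad (n\to\infty).$$ Let $b_{m,n}$ denote the number of rooted weighted bicolored plane trees of total weight $n$ with $m$ edges ($m,n\ge0$). Then $$h(s,t)=\sum_{m,n\ge0}b_{m,n}s^mt^n=\frac{1-t-\sqrt{1-(2+4s)t+(1+4s)t^2}}{2st}=1+st+(s+2s^2)t^2+(s+4s^2+5s^3)t^3+\cdots,$$ and for all integers $m,n\ge1$, $$b_{m,n}=\binom{n-1}{m-1}\mathrm{Cat}_m=\binom{n-1}{m-1}\frac{1}{m+1}\binom{2m}{m},$$ where $\mathrm{Cat}_m$ is the $m$-th Catalan number. Finally, for $n\ge1$ let $$c_n=\sum_T\frac{1}{|\mathrm{Aut}(T)|},$$ the sum taken over all isomorphism classes of non-rooted weighted bicolored plane trees $T$ of total weight $n$. Then $c_n=\sum_{m=1}^n \frac{b_{m,n}}{m}$.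
   Context: A weighted bicolored plane tree is a finite tree whose vertices are colored black and white so that every edge joins a black vertex to a white vertex, embedded in the plane (equivalently, with a fixed cyclic order of the edges around each vertex), and whose edges carry positive integer weights. Its total weight is the sum of the edge weights. Two such trees are isomorphic if there is an orientation-preserving homeomorphism of the plane (equivalently, a graph isomorphism preserving the cyclic orders at vertices) carrying one to the other that preserves vertex colors and edge weights; in particular exchanging the colors generally produces a different tree. $\mathrm{Aut}(T)$ is the group of such isomorphisms of $T$ to itself. A rooted tree is such a tree with a distinguished edge (the root), and isomorphisms of rooted trees must map root to root. By convention there is exactly one tree with no edges (a single uncolored vertex), of total weight $0$; it is counted as the unique rooted tree of weight $0$, so $a_0=b_{0,0}=1$. *)

theory Defs
  imports
    Complex_Main
    "HOL-Library.Landau_Symbols"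
    "HOL-Combinatorics.Orbits"
    "HOL-Computational_Algebra.Formal_Laurent_Series"
begin

section \<open>Undirected trees\<close>

text \<open>The edges of a simple graph are two-element sets of vertices.\<close>

definition connected_graph :: "'v set \<Rightarrow> 'v set set \<Rightarrow> bool" where
  "connected_graph V E \<longleftrightarrow>
     V \<noteq> {} \<and> (\<forall>u\<in>V. \<forall>v\<in>V. (u, v) \<in> {(x, y). {x, y} \<in> E}\<^sup>*)"

definition is_cycle :: "'v set set \<Rightarrow> 'v list \<Rightarrow> bool" where
  "is_cycle E c \<longleftrightarrow> length c \<ge> 3 \<and> distinct c \<and>
     (\<forall>i<length c. {c ! i, c ! (Suc i mod length c)} \<in> E)"

definition finite_tree :: "'v set \<Rightarrow> 'v set set \<Rightarrow> bool" where
  "finite_tree V E \<longleftrightarrow> finite V \<and> (\<forall>e\<in>E. e \<subseteq> V \<and> card e = 2) \<and>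
     connected_graph V E \<and> (\<nexists>c. is_cycle E c)"

section \<open>Weighted bicolored plane trees\<close>

datatype color = Black | White

text \<open>
  The plane embedding is given by its rotation system: \<open>rot T v\<close> sends an edge at the
  vertex \<open>v\<close> to the next one in the cyclic order around \<open>v\<close>. The colour \<open>None\<close> occurs only
  for the vertex of the tree without edges, which is uncolored. Values of the functions
  outside the tree carry no meaning; isomorphisms ignore them.
\<close>

record 'v wtree =
  verts :: "'v set"
  edges :: "'v set set"
  col :: "'v \<Rightarrow> color option"
  rot :: "'v \<Rightarrow> 'v set \<Rightarrow> 'v set"
  wt :: "'v set \<Rightarrow> nat"

definition incident :: "'v wtree \<Rightarrow> 'v \<Rightarrow> 'v set set" where
  "incident T v = {e \<in> edges T. v \<in> e}"

definition wbp_tree :: "'v wtree \<Rightarrow> bool" where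
  "wbp_tree T \<longleftrightarrow>
     finite_tree (verts T) (edges T) \<and>
     (\<forall>e\<in>edges T. \<exists>b w. e = {b, w} \<and> col T b = Some Black \<and> col T w = Some White) \<and>
     (edges T = {} \<longrightarrow> (\<forall>v\<in>verts T. col T v = None)) \<and>
     (\<forall>v\<in>verts T. incident T v \<noteq> {} \<longrightarrow> cyclic_on (rot T v) (incident T v)) \<and>
     (\<forall>e\<in>edges T. wt T e > 0)"

definition total_weight :: "'v wtree \<Rightarrow> nat" where
  "total_weight T = (\<Sum>e\<in>edges T. wt T e)"

definition tree_iso :: "('v \<Rightarrow> 'w) \<Rightarrow> 'v wtree \<Rightarrow> 'w wtree \<Rightarrow> bool" where
  "tree_iso \<phi> T T' \<longleftrightarrow>
     bij_betw \<phi> (verts T) (verts T') \<and>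
     (`) \<phi> ` edges T = edges T' \<and>
     (\<forall>v\<in>verts T. col T' (\<phi> v) = col T v) \<and>
     (\<forall>v\<in>verts T. \<forall>e\<in>incident T v. rot T' (\<phi> v) (\<phi> ` e) = \<phi> ` rot T v e) \<and>
     (\<forall>e\<in>edges T. wt T' (\<phi> ` e) = wt T e)"

text \<open>\<open>permutes\<close> pins an automorphism to the identity outside the tree, so that distinct
  elements of \<open>Aut T\<close> differ on the tree.\<close>

definition Aut :: "'v wtree \<Rightarrow> ('v \<Rightarrow> 'v) set" where
  "Aut T = {\<phi>. \<phi> permutes verts T \<and> tree_iso \<phi> T T}"

definition isomorphic :: "('v wtree \<times> 'v wtree) set" where
  "isomorphic = {(T, T'). wbp_tree T \<and> wbp_tree T' \<and> (\<exists>\<phi>. tree_iso \<phi> T T')}"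

text \<open>The root is an edge; it is absent exactly for the tree without edges, which counts
  as a rooted tree by convention.\<close>

definition rooted_wbp_tree :: "'v wtree \<times> 'v set option \<Rightarrow> bool" where
  "rooted_wbp_tree = (\<lambda>(T, r). wbp_tree T \<and>
     (case r of None \<Rightarrow> edges T = {} | Some e \<Rightarrow> e \<in> edges T))"

definition rooted_isomorphic ::
    "(('v wtree \<times> 'v set option) \<times> ('v wtree \<times> 'v set option)) set" where
  "rooted_isomorphic = {((T, r), (T', r')).
     rooted_wbp_tree (T, r) \<and> rooted_wbp_tree (T', r') \<and>
     (\<exists>\<phi>. tree_iso \<phi> T T' \<and> map_option ((`) \<phi>) r = r')}"

section \<open>Counting isomorphism classes\<close>

text \<open>Every finite tree has a copy with vertices in \<open>nat\<close>, so the isomorphism classes of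
  trees on \<open>nat\<close> stand for all isomorphism classes.\<close>

definition num_rooted :: "nat \<Rightarrow> nat" where
  "num_rooted n =
     card ({(T :: nat wtree, r). rooted_wbp_tree (T, r) \<and> total_weight T = n}
           // rooted_isomorphic)"

definition num_rooted_edges :: "nat \<Rightarrow> nat \<Rightarrow> nat" where
  "num_rooted_edges m n =
     card ({(T :: nat wtree, r). rooted_wbp_tree (T, r) \<and> total_weight T = n \<and>
              card (edges T) = m}
           // rooted_isomorphic)"

text \<open>The order of the automorphism group is constant on an isomorphism class, and
  \<open>the_elem\<close> extracts this common value.\<close>

definition unrooted_mass :: "nat \<Rightarrow> real" where
  "unrooted_mass n =
     (\<Sum>C\<in>{T :: nat wtree. wbp_tree T \<and> total_weight T = n} // isomorphic.
        1 / real (the_elem ((\<lambda>T. card (Aut T)) ` C)))"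

fun catalan :: "nat \<Rightarrow> nat" where
  "catalan 0 = 1"
| "catalan (Suc n) = (\<Sum>i\<le>n. catalan i * catalan (n - i))"

section \<open>Generating functions\<close>

definition rooted_gf :: "real fps" where
  "rooted_gf = Abs_fps (\<lambda>n. real (num_rooted n))"

text \<open>
  A double series in \<open>s\<close> and \<open>t\<close> is a power series in \<open>t\<close> whose coefficients are power
  series in \<open>s\<close>. These are embedded into the field of Laurent series in \<open>s\<close>,
  since the quotients considered here require division by \<open>s\<close>.
\<close>

definition rooted_edges_gf :: "real fls fps" where
  "rooted_edges_gf =
     Abs_fps (\<lambda>n. fps_to_fls (Abs_fps (\<lambda>m. real (num_rooted_edges m n))))"

text \<open>
  The square root with constant coefficient \<open>1\<close> of a power series with constant
  coefficient \<open>1\<close>. The first argument of \<open>fps_radical\<close> supplies the root of the constant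
  coefficient.

  The division of power series truncates when it is not exact. A numerator
  \<open>1 - t - fps_sqrt g\<close> has constant coefficient \<open>0\<close>, so its division by \<open>2 * t\<close> (and by
  \<open>2 * s * t\<close>, as \<open>s\<close> is invertible) is exact.
\<close>

definition fps_sqrt :: "'a :: field fps \<Rightarrow> 'a fps" where
  "fps_sqrt g = fps_radical (\<lambda>_ _. 1) 2 g"

lemma fps_sqrt_nth_0 [simp]: "fps_nth (fps_sqrt g) 0 = 1"
  by (simp add: fps_sqrt_def)

lemma fps_sqrt_power2:
  fixes g :: "'a :: field_char_0 fps"
  assumes "fps_nth g 0 = 1"
  shows "fps_sqrt g ^ 2 = g"
  using power_radical[of g "\<lambda>_ _. 1" 1] assms
  by (simp add: fps_sqrt_def numeral_2_eq_2)

end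

(*
  Cut the root edge e = {v, u} of a rooted tree, with v black. The component of u, rooted at the
  successor of e around u, and the component of v, rooted at the successor of e around v, are again
  rooted trees (up to exchanging the colours in the first). Iterating this identifies rooted trees
  with binary trees whose nodes carry the edge weights, so m edges of total weight n give
  Cat_m * (n - 1 choose m - 1) trees. The generating function satisfies
  (1 - t) (h - 1) = s t h^2, hence (1 - t - 2 s t h)^2 = (1 - t) (1 - (1 + 4 s) t). For s = 1 the
  coefficients are convolutions of those of sqrt (1 - t) and sqrt (1 - 5 t), and the latter factor
  governs the asymptotics.

  An automorphism fixing an edge is the identity, so Aut T acts freely on the m edges of T and
  T underlies m / |Aut T| rooted trees; summing 1 / m over the rooted trees of weight n gives c_n.
*)

theory Submission
  imports
    Defs
    "HOL-Analysis.Gamma_Function"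
    "HOL-Analysis.Generalised_Binomial_Theorem"
    "HOL-Analysis.Uniform_Limit"
    "HOL-Real_Asymp.Real_Asymp"
begin

unbundle no vec_syntax

(* Used as an introduction rule, ends_in_segment makes blast diverge on membership goals. *)
declare ends_in_segment [iff del]

section \<open>Trees and bridges\<close>

text \<open>The recursion alternates the colour of the base vertex. The objects that are cut are
  therefore trees with a marked vertex of either colour and an edge at it
  (\<open>dart_tree\<close>); black enters only in \<open>rooted_code\<close>, where it orients the
  root edge. Branches are not subterms of a tree, so codes are attached by a relation
  \<open>has_code\<close>, recursive in the code. To see that equal codes give isomorphic trees, two
  isomorphisms of branches must be glued; the delicate point is the rotation at the ends of the cut
  edge, since a branch alters it there. Rotations carry meaning only on the edges at a vertex, so
  cyclic orders are treated relative to that set. Once codes are a complete invariant, a class of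
  unrooted trees is the set of codes of its rootings, and these sets partition the codes of a given
  weight. This replaces any choice of representatives in the sum over classes.\<close>

definition adj :: "'v set set \<Rightarrow> ('v \<times> 'v) set" where
  "adj E = {(x, y). {x, y} \<in> E}"

lemma adj_iff [simp]: "(x, y) \<in> adj E \<longleftrightarrow> {x, y} \<in> E"
  by (simp add: adj_def)

lemma adj_mono: "E \<subseteq> E' \<Longrightarrow> adj E \<subseteq> adj E'"
  by (auto simp: adj_def)

lemma adj_rtrancl_mono: "(x, y) \<in> (adj E)\<^sup>* \<Longrightarrow> E \<subseteq> E' \<Longrightarrow> (x, y) \<in> (adj E')\<^sup>*"
  using rtrancl_mono[OF adj_mono] by blast

lemma adj_rtrancl_sym: "(x, y) \<in> (adj E)\<^sup>* \<Longrightarrow> (y, x) \<in> (adj E)\<^sup>*"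
proof -
  have "sym (adj E)" by (auto simp: sym_def insert_commute)
  then show "(x, y) \<in> (adj E)\<^sup>* \<Longrightarrow> (y, x) \<in> (adj E)\<^sup>*"
    by (meson sym_rtrancl symD)
qed

lemma connected_graph_adj:
  "connected_graph V E \<longleftrightarrow> V \<noteq> {} \<and> (\<forall>u\<in>V. \<forall>v\<in>V. (u, v) \<in> (adj E)\<^sup>*)"
  by (simp add: connected_graph_def adj_def)

text \<open>Induction from the front: if the new first vertex already lies on the path, everything
  before that occurrence is discarded; otherwise the vertex is prepended.\<close>

lemma rtrancl_simple_path:
  assumes "(x, y) \<in> R\<^sup>*"
  shows "\<exists>xs. xs \<noteq> [] \<and> hd xs = x \<and> last xs = y \<and> distinct xs \<and>
           (\<forall>i. Suc i < length xs \<longrightarrow> (xs ! i, xs ! Suc i) \<in> R)"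
  using assms
proof (induction rule: converse_rtrancl_induct)
  case base
  show ?case by (rule exI[of _ "[y]"]) auto
next
  case (step x z)
  then obtain xs where xs: "xs \<noteq> []" "hd xs = z" "last xs = y" "distinct xs"
    "\<And>i. Suc i < length xs \<Longrightarrow> (xs ! i, xs ! Suc i) \<in> R" by blast
  show ?case
  proof (cases "x \<in> set xs")
    case True
    then obtain us vs where us: "xs = us @ x # vs" by (meson split_list)
    have "((x # vs) ! i, (x # vs) ! Suc i) \<in> R" if "Suc i < length (x # vs)" for i
      using xs(5)[of "length us + i"] that us by (auto simp: nth_append)
    then show ?thesis
      using xs us by (intro exI[of _ "x # vs"]) auto
  next
    case False
    have "((x # xs) ! i, (x # xs) ! Suc i) \<in> R" if "Suc i < length (x # xs)" for i
      using that xs step(1) by (cases i) (auto simp: hd_conv_nth)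
    then show ?thesis
      using xs False by (intro exI[of _ "x # xs"]) auto
  qed
qed

text \<open>The form of acyclicity used from here on: it says directly that cutting an edge
  separates its ends, and it passes to subsets of edges and to joins without any cycle lists. The
  case x = y excludes loops.\<close>

definition all_bridges :: "'v set set \<Rightarrow> bool" where
  "all_bridges E \<longleftrightarrow> (\<forall>x y. {x, y} \<in> E \<longrightarrow> (x, y) \<notin> (adj (E - {{x, y}}))\<^sup>*)"

text \<open>A simple path from x to y that avoids the edge {x, y} closes up with it to a cycle. It
  has at least three vertices, because a path with two would be the deleted edge itself.\<close>

lemma acyclic_imp_all_bridges:
  assumes "\<nexists>c. is_cycle E c" and card2: "\<And>e. e \<in> E \<Longrightarrow> card e = 2"
  shows "all_bridges E"
  unfolding all_bridges_def
proof (intro allI impI notI)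
  fix x y assume e: "{x, y} \<in> E" and "(x, y) \<in> (adj (E - {{x, y}}))\<^sup>*"
  from rtrancl_simple_path[OF this(2)] obtain c where
    c: "c \<noteq> []" "hd c = x" "last c = y" "distinct c"
      "\<And>i. Suc i < length c \<Longrightarrow> {c ! i, c ! Suc i} \<in> E - {{x, y}}" by auto
  have "x \<noteq> y" using card2[OF e] by auto
  have len: "length c \<ge> 3"
  proof (rule ccontr)
    assume "\<not> length c \<ge> 3"
    then have "length c = 1 \<or> length c = 2" using c(1) by (cases c; cases "tl c"; cases "tl (tl c)") auto
    then show False
    proof
      assume "length c = 1"
      then show False using c \<open>x \<noteq> y\<close> by (auto simp: length_Suc_conv)
    next
      assume "length c = 2"
      then obtain p q where "c = [p, q]" by (auto simp: length_Suc_conv numeral_2_eq_2)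
      then show False using c(2,3) c(5)[of 0] by auto
    qed
  qed
  have "{c ! i, c ! (Suc i mod length c)} \<in> E" if "i < length c" for i
  proof (cases "Suc i < length c")
    case True
    then show ?thesis using c(5)[OF True] by simp
  next
    case False
    then have i: "Suc i = length c" using that by simp
    then have "c ! i = y" using c(1,3) by (metis diff_Suc_1 last_conv_nth)
    moreover have "c ! 0 = x" using c(1,2) by (simp add: hd_conv_nth)
    ultimately show ?thesis using i e by (simp add: insert_commute)
  qed
  then have "is_cycle E c" unfolding is_cycle_def using len c(4) by auto
  then show False using assms(1) by blast
qed

text \<open>The rest of a cycle joins the ends of its closing edge, and distinctness together with
  length at least 3 keeps the closing edge from occurring in that rest.\<close>

lemma all_bridges_imp_acyclic:
  assumes "all_bridges E"
  shows "\<not> is_cycle E c"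
proof
  assume "is_cycle E c"
  then have len: "length c \<ge> 3" and dist: "distinct c"
    and ed: "\<And>i. i < length c \<Longrightarrow> {c ! i, c ! (Suc i mod length c)} \<in> E"
    by (auto simp: is_cycle_def)
  let ?n = "length c - 1"
  let ?e = "{c ! 0, c ! ?n}"
  have e: "?e \<in> E"
    using ed[of ?n] len by (cases c) (auto simp: insert_commute)
  have "i \<le> ?n \<longrightarrow> (c ! 0, c ! i) \<in> (adj (E - {?e}))\<^sup>*" for i
  proof (induction i)
    case (Suc i)
    show ?case
    proof
      assume i: "Suc i \<le> ?n"
      then have "{c ! i, c ! Suc i} \<in> E" using ed[of i] by auto
      moreover have "{c ! i, c ! Suc i} \<noteq> ?e"
      proof -
        have "c ! i = c ! 0 \<longleftrightarrow> i = 0" "c ! i = c ! ?n \<longleftrightarrow> i = ?n" "c ! Suc i = c ! ?n \<longleftrightarrow> Suc i = ?n"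
          using i len by (intro nth_eq_iff_index_eq[OF dist]; linarith)+
        moreover have "i = 0 \<longrightarrow> Suc i \<noteq> ?n" "i \<noteq> ?n" using i len by linarith+
        ultimately show ?thesis unfolding doubleton_eq_iff by blast
      qed
      ultimately have "(c ! i, c ! Suc i) \<in> adj (E - {?e})" unfolding adj_def by blast
      moreover have "(c ! 0, c ! i) \<in> (adj (E - {?e}))\<^sup>*" using Suc i by linarith
      ultimately show "(c ! 0, c ! Suc i) \<in> (adj (E - {?e}))\<^sup>*" by (rule rtrancl_into_rtrancl[rotated])
    qed
  qed simp
  from this[of ?n] have "(c ! 0, c ! ?n) \<in> (adj (E - {?e}))\<^sup>*" by simp
  then show False using assms e unfolding all_bridges_def by blast
qed

lemma finite_tree_iff:
  "finite_tree V E \<longleftrightarrow> finite V \<and> (\<forall>e\<in>E. e \<subseteq> V \<and> card e = 2) \<and>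
     connected_graph V E \<and> all_bridges E"
  using acyclic_imp_all_bridges[of E] all_bridges_imp_acyclic[of E]
  unfolding finite_tree_def by blast

lemma all_bridges_subset: "all_bridges E \<Longrightarrow> E' \<subseteq> E \<Longrightarrow> all_bridges E'"
  unfolding all_bridges_def
proof (intro allI impI)
  fix x y assume "\<forall>x y. {x, y} \<in> E \<longrightarrow> (x, y) \<notin> (adj (E - {{x, y}}))\<^sup>*" "E' \<subseteq> E" "{x, y} \<in> E'"
  moreover have "E' - {{x, y}} \<subseteq> E - {{x, y}}" using calculation(2) by blast
  note adj_rtrancl_mono[OF _ this, of x y]
  ultimately show "(x, y) \<notin> (adj (E' - {{x, y}}))\<^sup>*" by blast
qed

section \<open>Cyclic orders\<close>

text \<open>Every element of S lies in its own orbit and so has a preimage in S. Thus f maps S onto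
  itself, and finiteness of S turns this into injectivity; f is arbitrary outside S.\<close>

lemma cyclic_on_inj_on:
  assumes "cyclic_on f S"
  shows "inj_on f S"
proof (rule eq_card_imp_inj_on)
  show fin: "finite S" by (rule finite_cyclic_on[OF assms])
  have "S \<subseteq> f ` S"
  proof
    fix x assume "x \<in> S"
    then have "x \<in> orbit f x" using assms by (auto simp: cyclic_on_alldef)
    moreover have "y \<in> f ` S" if "y \<in> orbit f x" for y
      using that
    proof cases
      case base
      then show ?thesis using \<open>x \<in> S\<close> by blast
    next
      case (step z)
      then show ?thesis using \<open>x \<in> S\<close> assms by (auto simp: cyclic_on_alldef)
    qed
    ultimately show "x \<in> f ` S" by blast
  qed
  moreover have "f ` S \<subseteq> S" using cyclic_on_inI[OF assms] by blast
  ultimately show "card (f ` S) = card S" by (simp add: subset_antisym)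
qed

lemma cyclic_on_fixpoint:
  assumes "cyclic_on f S" "e \<in> S" "f e = e"
  shows "S = {e}"
proof -
  have "x = e" if "x \<in> orbit f e" for x
    using that by induction (simp_all add: assms)
  moreover have "S = orbit f e" using assms unfolding cyclic_on_alldef by blast
  ultimately show ?thesis using assms(2) by blast
qed

lemma cyclic_onI_reach:
  assumes "S \<noteq> {}" "\<And>x. x \<in> S \<Longrightarrow> f x \<in> S" "\<And>x y. x \<in> S \<Longrightarrow> y \<in> S \<Longrightarrow> y \<in> orbit f x"
  shows "cyclic_on f S"
proof -
  have "y \<in> S" if "x \<in> S" "y \<in> orbit f x" for x y
    using that(2) by induction (auto simp: assms that)
  then show ?thesis unfolding cyclic_on_alldef using assms by blast
qed

text \<open>The map g skips e. Along an f-orbit the invariant is that the current element is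
  g-reachable, or, when it is e, that its successor \<open>f e\<close> already is.\<close>

lemma cyclic_on_delete:
  assumes f: "cyclic_on f S" and e: "e \<in> S" and ne: "f e \<noteq> e"
    and g: "\<And>x. x \<in> S - {e} \<Longrightarrow> g x = (if f x = e then f e else f x)"
  shows "cyclic_on g (S - {e})"
proof (rule cyclic_onI_reach)
  have S: "f x \<in> S" if "x \<in> S" for x using cyclic_on_inI[OF f that] .
  show "S - {e} \<noteq> {}" using S[OF e] ne by auto
  show closed: "g x \<in> S - {e}" if "x \<in> S - {e}" for x
    using that S[OF e] S[of x] ne g[OF that] by auto
  fix x y assume x: "x \<in> S - {e}" and y: "y \<in> S - {e}"
  have "z \<in> S \<and> (if z = e then f e \<in> orbit g x else z \<in> orbit g x)" if "z \<in> orbit f x" for z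
    using that
  proof induction
    case base
    show ?case using x S[of x] orbit.base[of g x] g[OF x] by auto
  next
    case (step z)
    show ?case
    proof (cases "z = e")
      case True
      then show ?thesis using step S e ne by auto
    next
      case False
      then have "g z \<in> orbit g x" using step by (auto intro: orbit.step)
      then show ?thesis using False step S g[of z] by auto
    qed
  qed
  moreover have "y \<in> orbit f x" using f x y by (auto simp: cyclic_on_alldef)
  ultimately show "y \<in> orbit g x" using y by auto
qed

text \<open>One step of f is one step of g, or two when g passes through e on the way to r; so
  f-orbits stay reachable. The element e itself is reached from the f-predecessor p of r, which
  exists because f is injective on the finite set S.\<close>

lemma cyclic_on_insert:
  assumes f: "cyclic_on f S" and e: "e \<notin> S" and r: "r \<in> S"
    and g: "\<And>x. x \<in> S \<Longrightarrow> g x = (if f x = r then e else f x)" "g e = r"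
  shows "cyclic_on g (insert e S)"
proof (rule cyclic_onI_reach)
  have S: "f x \<in> S" if "x \<in> S" for x using cyclic_on_inI[OF f that] .
  show "g x \<in> insert e S" if "x \<in> insert e S" for x
    using that S g r by (cases "x = e") auto
  have reach: "z \<in> S \<and> z \<in> orbit g x" if x: "x \<in> S" and "z \<in> orbit f x" for x z
    using that(2)
  proof induction
    case base
    have "g x \<in> orbit g x" "g (g x) \<in> orbit g x" by (auto intro: orbit.intros)
    then show ?case using S[OF x] g(1)[OF x] g(2) by (auto split: if_splits)
  next
    case (step z)
    then have "g z \<in> orbit g x" "g (g z) \<in> orbit g x" by (auto intro: orbit.intros)
    then show ?case using step S[of z] g(1)[of z] g(2) by (auto split: if_splits)
  qed
  have SS: "y \<in> orbit g x" if "x \<in> S" "y \<in> S" for x y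
    using reach[OF that(1)] f that by (auto simp: cyclic_on_alldef)
  have "r \<in> f ` S"
    using f r cyclic_on_inj_on[OF f] finite_cyclic_on[OF f] cyclic_on_inI[OF f]
    by (metis endo_inj_surj image_subsetI)
  then obtain p where p: "p \<in> S" "f p = r" by auto
  have eS: "e \<in> orbit g x" if "x \<in> S" for x
    using orbit.step[OF SS[OF that p(1)]] g(1)[OF p(1)] p(2) by simp
  have Se: "y \<in> orbit g e" if "y \<in> S" for y
    using orbit_trans[OF SS[OF r that], of e] orbit.base[of g e] g(2) by simp
  have ee: "e \<in> orbit g e" using orbit_trans[OF eS[OF r] Se[OF r]] .
  show "y \<in> orbit g x" if "x \<in> insert e S" "y \<in> insert e S" for x y
    using that eS SS Se ee by blast
qed auto

section \<open>Branches of a plane tree\<close>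

text \<open>Unlike in \<open>wbp_tree\<close>, a tree without edges may be coloured: a branch
  inherits the colours of the whole tree and may consist of a single coloured vertex.\<close>

definition plane_tree :: "'v wtree \<Rightarrow> bool" where
  "plane_tree T \<longleftrightarrow>
     finite_tree (verts T) (edges T) \<and>
     (\<forall>e\<in>edges T. \<exists>b w. e = {b, w} \<and> col T b = Some Black \<and> col T w = Some White) \<and>
     (\<forall>v\<in>verts T. incident T v \<noteq> {} \<longrightarrow> cyclic_on (rot T v) (incident T v)) \<and>
     (\<forall>e\<in>edges T. wt T e > 0)"

text \<open>The base vertex orients the root edge, so that both branches of a cut are objects of the
  same kind, whichever colours their base vertices have.\<close>

definition dart_tree :: "'v wtree \<Rightarrow> 'v \<Rightarrow> 'v set option \<Rightarrow> bool" where
  "dart_tree T v r \<longleftrightarrow> plane_tree T \<and> v \<in> verts T \<and>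
     (case r of None \<Rightarrow> edges T = {} | Some e \<Rightarrow> e \<in> incident T v)"

definition branch_verts :: "'v wtree \<Rightarrow> 'v \<Rightarrow> 'v set \<Rightarrow> 'v set" where
  "branch_verts T v e = {x. (v, x) \<in> (adj (edges T - {e}))\<^sup>*}"

text \<open>Cutting \<open>e\<close> removes it from the cyclic order around \<open>v\<close>; the edge that followed it becomes
  the root of the branch.\<close>

definition branch :: "'v wtree \<Rightarrow> 'v \<Rightarrow> 'v set \<Rightarrow> 'v wtree" where
  "branch T v e =
     \<lparr>verts = branch_verts T v e,
      edges = {d \<in> edges T - {e}. d \<subseteq> branch_verts T v e},
      col = col T,
      rot = \<lambda>x d. if x = v \<and> rot T v d = e then rot T v e else rot T x d,
      wt = wt T\<rparr>"

text \<open>A fixed point of the rotation means that e is the only edge at v. The branch is then the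
  single vertex v, whose root is \<open>None\<close> as \<open>dart_tree\<close> requires.\<close>

definition branch_root :: "'v wtree \<Rightarrow> 'v \<Rightarrow> 'v set \<Rightarrow> 'v set option" where
  "branch_root T v e = (if rot T v e = e then None else Some (rot T v e))"

lemma branch_simps [simp]:
  "verts (branch T v e) = branch_verts T v e"
  "edges (branch T v e) = {d \<in> edges T - {e}. d \<subseteq> branch_verts T v e}"
  "col (branch T v e) = col T"
  "rot (branch T v e) x d = (if x = v \<and> rot T v d = e then rot T v e else rot T x d)"
  "wt (branch T v e) = wt T"
  by (simp_all add: branch_def)

lemma plane_treeD:
  assumes "plane_tree T"
  shows plane_tree_finite: "finite (verts T)"
    and plane_tree_edge_subset: "\<And>e. e \<in> edges T \<Longrightarrow> e \<subseteq> verts T"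
    and plane_tree_edge_card: "\<And>e. e \<in> edges T \<Longrightarrow> card e = 2"
    and plane_tree_connected: "\<And>x y. x \<in> verts T \<Longrightarrow> y \<in> verts T \<Longrightarrow> (x, y) \<in> (adj (edges T))\<^sup>*"
    and plane_tree_bridges: "all_bridges (edges T)"
    and plane_tree_cyclic:
      "\<And>x. x \<in> verts T \<Longrightarrow> incident T x \<noteq> {} \<Longrightarrow> cyclic_on (rot T x) (incident T x)"
    and plane_tree_wt: "\<And>e. e \<in> edges T \<Longrightarrow> wt T e > 0"
  using assms unfolding plane_tree_def finite_tree_iff connected_graph_adj by auto

lemma plane_tree_finite_edges: "plane_tree T \<Longrightarrow> finite (edges T)"
  by (meson Pow_iff finite_Pow_iff finite_subset plane_tree_edge_subset plane_tree_finite subsetI)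

lemma plane_tree_no_incident:
  assumes "plane_tree T" "v \<in> verts T" "incident T v = {}"
  shows "edges T = {}" "verts T = {v}"
proof -
  have "x = v" if "x \<in> verts T" for x
    using plane_tree_connected[OF assms(1,2) that]
  proof (cases rule: converse_rtranclE)
    case (step y)
    then have "{v, y} \<in> incident T v" by (simp add: incident_def)
    then show ?thesis using assms(3) by blast
  qed simp
  then show V: "verts T = {v}" using assms(2) by blast
  show "edges T = {}"
  proof (rule ccontr)
    assume "edges T \<noteq> {}"
    then obtain e where "e \<in> edges T" by blast
    with plane_tree_edge_subset[OF assms(1) this] plane_tree_edge_card[OF assms(1) this] V
    have "e = {v}" by (cases "e = {}") auto
    with plane_tree_edge_card[OF assms(1) \<open>e \<in> edges T\<close>] show False by simp
  qed
qed

lemma plane_tree_incident_edge: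
  assumes "plane_tree T" "v \<in> verts T" "e \<in> incident T v"
  obtains u where "e = {v, u}" "u \<noteq> v"
proof -
  have "card e = 2" "v \<in> e" using assms plane_tree_edge_card by (auto simp: incident_def)
  then obtain x y where "e = {x, y}" "x \<noteq> y" by (auto simp: card_2_iff)
  with \<open>v \<in> e\<close> show ?thesis by (metis insertE insert_commute singletonD that)
qed

section \<open>Cutting an edge: the side of one of its ends\<close>

context
  fixes T :: "'v wtree" and v u :: 'v
  assumes T: "plane_tree T" and e: "{v, u} \<in> edges T"
begin

lemma branch_ends: "v \<in> verts T" "u \<in> verts T" "v \<noteq> u"
  using plane_tree_edge_subset[OF T e] plane_tree_edge_card[OF T e] by auto

lemma branch_verts_self: "v \<in> branch_verts T v {v, u}"
  by (simp add: branch_verts_def)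

lemma branch_verts_disjoint: "branch_verts T v {v, u} \<inter> branch_verts T u {v, u} = {}"
proof -
  have "(v, u) \<notin> (adj (edges T - {{v, u}}))\<^sup>*"
    using plane_tree_bridges[OF T] e unfolding all_bridges_def by blast
  then have "\<not> ((v, x) \<in> (adj (edges T - {{v, u}}))\<^sup>* \<and> (u, x) \<in> (adj (edges T - {{v, u}}))\<^sup>*)" for x
    using adj_rtrancl_sym[of u x] rtrancl_trans[of v x _ u] by blast
  then show ?thesis unfolding branch_verts_def by blast
qed

lemma branch_verts_edge:
  assumes "d \<in> edges T" "d \<noteq> {v, u}" "x \<in> d" "x \<in> branch_verts T v {v, u}"
  shows "d \<subseteq> branch_verts T v {v, u}"
proof
  fix y assume "y \<in> d"
  show "y \<in> branch_verts T v {v, u}"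
  proof (cases "x = y")
    case False
    with plane_tree_edge_card[OF T assms(1)] assms(3) \<open>y \<in> d\<close> have "d = {x, y}"
      by (auto simp: card_2_iff)
    then have "(x, y) \<in> adj (edges T - {{v, u}})" using assms by auto
    then show ?thesis
      using assms(4) rtrancl_into_rtrancl[of v x _ y] unfolding branch_verts_def by blast
  qed (use assms in simp)
qed

text \<open>Along a walk from v, a step other than the cut edge stays on its side, and a step across
  the cut edge lands on v or u, the starting points of the two sides.\<close>

lemma branch_verts_Un: "branch_verts T v {v, u} \<union> branch_verts T u {v, u} = verts T"
proof -
  have sub: "branch_verts T w {v, u} \<subseteq> verts T" if "w \<in> verts T" for w
  proof
    fix x assume "x \<in> branch_verts T w {v, u}"
    then have "(w, x) \<in> (adj (edges T - {{v, u}}))\<^sup>*" by (simp add: branch_verts_def)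
    then show "x \<in> verts T"
      using that
    proof (induction rule: rtrancl_induct)
      case (step y z)
      then have "{y, z} \<in> edges T" by simp
      then show ?case using plane_tree_edge_subset[OF T] by blast
    qed
  qed
  have "x \<in> branch_verts T v {v, u} \<union> branch_verts T u {v, u}" if "x \<in> verts T" for x
    using plane_tree_connected[OF T branch_ends(1) that]
  proof (induction rule: rtrancl_induct)
    case base
    show ?case using branch_verts_self by blast
  next
    case (step y z)
    show ?case
    proof (cases "{y, z} = {v, u}")
      case True
      then have "z = v \<or> z = u" by (auto simp: doubleton_eq_iff)
      then show ?thesis by (auto simp: branch_verts_def)
    next
      case False
      then have "(y, z) \<in> adj (edges T - {{v, u}})" using step by simp
      then show ?thesis
        using step(3) rtrancl_into_rtrancl[of _ y _ z] unfolding branch_verts_def by blast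
    qed
  qed
  then show ?thesis using sub branch_ends by blast
qed

lemma incident_branch:
  assumes "x \<in> branch_verts T v {v, u}"
  shows "incident (branch T v {v, u}) x = incident T x - {{v, u}}"
  using assms branch_verts_edge by (auto simp: incident_def)

lemma branch_cut_edge:
  assumes "x \<in> branch_verts T v {v, u}" "x \<noteq> v"
  shows "{v, u} \<notin> incident T x"
proof
  assume "{v, u} \<in> incident T x"
  then have "x = u" using assms by (auto simp: incident_def)
  then show False using assms(1) branch_verts_disjoint by (auto simp: branch_verts_def)
qed

lemma branch_plane_tree: "plane_tree (branch T v {v, u})"
  unfolding plane_tree_def finite_tree_iff
proof (intro conjI ballI impI)
  show "finite (verts (branch T v {v, u}))"
    using plane_tree_finite[OF T] branch_verts_Un by (metis branch_simps(1) finite_Un)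
  fix d assume d: "d \<in> edges (branch T v {v, u})"
  then have dT: "d \<in> edges T" by simp
  show "d \<subseteq> verts (branch T v {v, u})" using d by simp
  show "card d = 2" using plane_tree_edge_card[OF T dT] .
  show "\<exists>b w. d = {b, w} \<and> col (branch T v {v, u}) b = Some Black
      \<and> col (branch T v {v, u}) w = Some White"
    using T dT by (simp add: plane_tree_def)
  show "wt (branch T v {v, u}) d > 0" using plane_tree_wt[OF T dT] by simp
next
  have reach: "x \<in> branch_verts T v {v, u} \<and> (v, x) \<in> (adj (edges (branch T v {v, u})))\<^sup>*"
    if "(v, x) \<in> (adj (edges T - {{v, u}}))\<^sup>*" for x
    using that
  proof (induction rule: rtrancl_induct)
    case base
    show ?case using branch_verts_self by simp
  next
    case (step y z)
    have "{y, z} \<subseteq> branch_verts T v {v, u}"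
      using step by (intro branch_verts_edge[of _ y]) auto
    then have "(y, z) \<in> adj (edges (branch T v {v, u}))" using step by simp
    with step show ?case
      using \<open>{y, z} \<subseteq> _\<close> rtrancl_into_rtrancl[of v y _ z] by blast
  qed
  show "connected_graph (verts (branch T v {v, u})) (edges (branch T v {v, u}))"
    unfolding connected_graph_adj
  proof (intro conjI ballI)
    show "verts (branch T v {v, u}) \<noteq> {}" using branch_verts_self by auto
    fix x y assume "x \<in> verts (branch T v {v, u})" "y \<in> verts (branch T v {v, u})"
    then have "(v, x) \<in> (adj (edges (branch T v {v, u})))\<^sup>*"
      "(v, y) \<in> (adj (edges (branch T v {v, u})))\<^sup>*"
      using reach by (simp_all add: branch_verts_def)
    then show "(x, y) \<in> (adj (edges (branch T v {v, u})))\<^sup>*"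
      by (meson adj_rtrancl_sym rtrancl_trans)
  qed
  show "all_bridges (edges (branch T v {v, u}))"
    by (rule all_bridges_subset[OF plane_tree_bridges[OF T]]) auto
next
  fix x assume x: "x \<in> verts (branch T v {v, u})" and ne: "incident (branch T v {v, u}) x \<noteq> {}"
  have xT: "x \<in> verts T" using x branch_verts_Un by auto
  have inc: "incident (branch T v {v, u}) x = incident T x - {{v, u}}"
    using x by (intro incident_branch) simp
  have cyc: "cyclic_on (rot T x) (incident T x)"
    using plane_tree_cyclic[OF T xT] ne inc by blast
  \<comment> \<open>Only v loses an edge within its branch. There the edge before the cut edge now
    leads to the edge after it; a fixed point of the rotation would leave no edge at v.\<close>
  show "cyclic_on (rot (branch T v {v, u}) x) (incident (branch T v {v, u}) x)"
  proof (cases "x = v")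
    case True
    have eS: "{v, u} \<in> incident T x" using e True by (simp add: incident_def)
    have "rot T x {v, u} \<noteq> {v, u}"
      using cyclic_on_fixpoint[OF cyc eS] inc ne by auto
    then show ?thesis
      unfolding inc using True by (intro cyclic_on_delete[OF cyc eS]) auto
  next
    case False
    then have "incident (branch T v {v, u}) x = incident T x"
      using inc branch_cut_edge x by auto
    moreover have "rot (branch T v {v, u}) x = rot T x" using False by auto
    ultimately show ?thesis using cyc by simp
  qed
qed

lemma rot_fixpoint_incident:
  assumes "rot T v {v, u} = {v, u}"
  shows "incident T v = {{v, u}}"
proof -
  have "{v, u} \<in> incident T v" using e by (simp add: incident_def)
  then show ?thesis
    using cyclic_on_fixpoint[OF plane_tree_cyclic[OF T branch_ends(1)] _ assms] by blast
qed

lemma branch_dart_tree: "dart_tree (branch T v {v, u}) v (branch_root T v {v, u})"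
  unfolding dart_tree_def
proof (intro conjI)
  show "plane_tree (branch T v {v, u})" by (rule branch_plane_tree)
  show v: "v \<in> verts (branch T v {v, u})" using branch_verts_self by simp
  have inc: "incident (branch T v {v, u}) v = incident T v - {{v, u}}"
    by (rule incident_branch[OF branch_verts_self])
  have eS: "{v, u} \<in> incident T v" using e by (simp add: incident_def)
  show "case branch_root T v {v, u} of None \<Rightarrow> edges (branch T v {v, u}) = {}
      | Some e \<Rightarrow> e \<in> incident (branch T v {v, u}) v"
  proof (cases "rot T v {v, u} = {v, u}")
    case True
    then have "incident (branch T v {v, u}) v = {}" using rot_fixpoint_incident inc by simp
    then have "edges (branch T v {v, u}) = {}"
      using plane_tree_no_incident(1)[OF branch_plane_tree v] by blast
    then show ?thesis using True by (simp add: branch_root_def)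
  next
    case False
    have "rot T v {v, u} \<in> incident T v"
      using cyclic_on_inI[OF plane_tree_cyclic[OF T branch_ends(1)] eS] eS by blast
    then show ?thesis using False inc by (simp add: branch_root_def)
  qed
qed

end

text \<open>An edge other than the cut edge lies entirely on the side of any one of its ends, and no
  edge fits into both sides because they share no vertex.\<close>

lemma branch_edges:
  assumes T: "plane_tree T" and e: "{v, u} \<in> edges T"
  defines "E1 \<equiv> edges (branch T u {v, u})" and "E2 \<equiv> edges (branch T v {v, u})"
  shows "edges T = insert {v, u} (E1 \<union> E2)" "{v, u} \<notin> E1 \<union> E2" "E1 \<inter> E2 = {}"
proof -
  have e': "{u, v} \<in> edges T" using e by (simp add: insert_commute)
  have "d \<in> E1 \<union> E2" if d: "d \<in> edges T" "d \<noteq> {v, u}" for d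
  proof -
    obtain x y where "d = {x, y}" using plane_tree_edge_card[OF T d(1)] by (auto simp: card_2_iff)
    then have x: "x \<in> d" by simp
    then have "x \<in> verts T" using plane_tree_edge_subset[OF T d(1)] by blast
    then consider "x \<in> branch_verts T v {v, u}" | "x \<in> branch_verts T u {u, v}"
      using branch_verts_Un[OF T e] by (auto simp: insert_commute)
    then show ?thesis
    proof cases
      case 1
      then show ?thesis using branch_verts_edge[OF T e d x] d by (simp add: E2_def)
    next
      case 2
      have "d \<noteq> {u, v}" using d by (simp add: insert_commute)
      then show ?thesis
        using branch_verts_edge[OF T e' d(1) _ x] 2 d by (simp add: E1_def insert_commute)
    qed
  qed
  then show "edges T = insert {v, u} (E1 \<union> E2)" using e by (auto simp: E1_def E2_def)
  show "{v, u} \<notin> E1 \<union> E2" by (simp add: E1_def E2_def)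
  show "E1 \<inter> E2 = {}"
  proof (rule equals0I)
    fix d assume "d \<in> E1 \<inter> E2"
    then have "d \<subseteq> {}" "d \<in> edges T"
      using branch_verts_disjoint[OF T e] by (auto simp: E1_def E2_def)
    then show False using plane_tree_edge_card[OF T, of d] by auto
  qed
qed

section \<open>Codes\<close>

text \<open>A node with label \<open>k\<close> stands for an edge of weight \<open>k + 1\<close>.\<close>

datatype btree = Leaf | Node nat btree btree

primrec nodes :: "btree \<Rightarrow> nat" where
  "nodes Leaf = 0"
| "nodes (Node k L R) = Suc (nodes L + nodes R)"

primrec weight :: "btree \<Rightarrow> nat" where
  "weight Leaf = 0"
| "weight (Node k L R) = Suc k + weight L + weight R"

text \<open>The left subtree belongs to the far end u, the right one to the base vertex v. For a
  \<open>dart_tree\<close> the root \<open>None\<close> in the first clause means that there are no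
  edges. Colours do not occur, so the clause for u needs no recolouring.\<close>

primrec has_code :: "btree \<Rightarrow> 'v wtree \<Rightarrow> 'v \<Rightarrow> 'v set option \<Rightarrow> bool" where
  "has_code Leaf T v r \<longleftrightarrow> r = None"
| "has_code (Node k L R) T v r \<longleftrightarrow> (\<exists>u. r = Some {v, u} \<and> u \<noteq> v \<and> wt T {v, u} = Suc k \<and>
     has_code L (branch T u {v, u}) u (branch_root T u {v, u}) \<and>
     has_code R (branch T v {v, u}) v (branch_root T v {v, u}))"

lemma branch_dart_trees:
  assumes "plane_tree T" "{v, u} \<in> edges T"
  shows "dart_tree (branch T v {v, u}) v (branch_root T v {v, u})"
    and "dart_tree (branch T u {v, u}) u (branch_root T u {v, u})"
  using branch_dart_tree[OF assms] branch_dart_tree[of T u v] assms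
  by (simp_all add: insert_commute)

text \<open>Both branches lack the cut edge, so the number of edges decreases. A weight w becomes
  the label w - 1, which loses nothing as weights are positive.\<close>

lemma has_code_exists:
  assumes "dart_tree T v r"
  shows "\<exists>c. has_code c T v r"
  using assms
proof (induction "card (edges T)" arbitrary: T v r rule: less_induct)
  case less
  note T = less(2)
  show ?case
  proof (cases r)
    case None
    then show ?thesis by (intro exI[of _ Leaf]) simp
  next
    case (Some e)
    have P: "plane_tree T" and v: "v \<in> verts T" and e: "e \<in> incident T v"
      using T Some by (auto simp: dart_tree_def)
    obtain u where u: "e = {v, u}" "u \<noteq> v" using plane_tree_incident_edge[OF P v e] .
    have eE: "{v, u} \<in> edges T" using e u by (simp add: incident_def)
    have fin: "finite (edges T)" by (rule plane_tree_finite_edges[OF P])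
    have "card (edges (branch T w {v, u})) < card (edges T)" for w
      using eE by (intro psubset_card_mono[OF fin]) auto
    then obtain L R where "has_code L (branch T u {v, u}) u (branch_root T u {v, u})"
      "has_code R (branch T v {v, u}) v (branch_root T v {v, u})"
      using less(1) branch_dart_trees[OF P eE] by meson
    moreover have "wt T {v, u} = Suc (wt T {v, u} - 1)"
      using plane_tree_wt[OF P eE] by simp
    ultimately have "has_code (Node (wt T {v, u} - 1) L R) T v r"
      using Some u by auto
    then show ?thesis by blast
  qed
qed

text \<open>Given v, the root edge determines its other end u, so both codes unfold with the same
  witness.\<close>

lemma has_code_unique: "has_code c T v r \<Longrightarrow> has_code c' T v r \<Longrightarrow> c = c'"
proof (induction c arbitrary: c' T v r)
  case Leaf
  then show ?case by (cases c') auto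
next
  case (Node k L R)
  obtain k' L' R' where c': "c' = Node k' L' R'" using Node(3,4) by (cases c') auto
  then show ?case using Node by (auto simp: doubleton_eq_iff)
qed

lemma has_code_size:
  assumes "dart_tree T v r" "has_code c T v r"
  shows "card (edges T) = nodes c \<and> total_weight T = weight c"
  using assms
proof (induction c arbitrary: T v r)
  case Leaf
  then show ?case by (simp add: dart_tree_def total_weight_def)
next
  case (Node k L R)
  then obtain u where u: "r = Some {v, u}" "u \<noteq> v" "wt T {v, u} = Suc k"
    and L: "has_code L (branch T u {v, u}) u (branch_root T u {v, u})"
    and R: "has_code R (branch T v {v, u}) v (branch_root T v {v, u})" by auto
  have P: "plane_tree T" and eE: "{v, u} \<in> edges T"
    using Node(3) u by (auto simp: dart_tree_def incident_def)
  note D = branch_dart_trees[OF P eE]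
  note E = branch_edges[OF P eE]
  have fin: "finite (edges (branch T u {v, u}))" "finite (edges (branch T v {v, u}))"
    using D plane_tree_finite_edges unfolding dart_tree_def by blast+
  note IH = Node(1)[OF D(2) L] Node(2)[OF D(1) R]
  have "card (edges T) = nodes (Node k L R)"
    unfolding E(1) using IH E(2,3) fin by (simp add: card_insert_if card_Un_disjoint del: branch_simps)
  moreover have "total_weight T = weight (Node k L R)"
    unfolding total_weight_def E(1) using IH E(2,3) fin u(3)
    by (simp add: sum.union_disjoint total_weight_def del: branch_simps(2))
  ultimately show ?case by simp
qed

section \<open>Isomorphisms and codes\<close>

text \<open>Forgetting the colours spares a recolouring of the branch whose base vertex is white: the
  colour of one vertex determines all others.\<close>

definition plane_iso :: "('v \<Rightarrow> 'w) \<Rightarrow> 'v wtree \<Rightarrow> 'w wtree \<Rightarrow> bool" where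
  "plane_iso \<phi> T T' \<longleftrightarrow>
     bij_betw \<phi> (verts T) (verts T') \<and>
     (`) \<phi> ` edges T = edges T' \<and>
     (\<forall>v\<in>verts T. \<forall>e\<in>incident T v. rot T' (\<phi> v) (\<phi> ` e) = \<phi> ` rot T v e) \<and>
     (\<forall>e\<in>edges T. wt T' (\<phi> ` e) = wt T e)"

lemma tree_iso_iff_plane_iso:
  "tree_iso \<phi> T T' \<longleftrightarrow> plane_iso \<phi> T T' \<and> (\<forall>v\<in>verts T. col T' (\<phi> v) = col T v)"
  unfolding tree_iso_def plane_iso_def by blast

lemma plane_iso_rot:
  "plane_iso \<phi> T T' \<Longrightarrow> v \<in> verts T \<Longrightarrow> e \<in> incident T v \<Longrightarrow>
     rot T' (\<phi> v) (\<phi> ` e) = \<phi> ` rot T v e"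
  by (simp add: plane_iso_def)

lemma plane_tree_rot_incident:
  assumes "plane_tree T" "v \<in> verts T" "d \<in> incident T v"
  shows "rot T v d \<in> incident T v"
proof -
  have "incident T v \<noteq> {}" using assms(3) by blast
  from cyclic_on_inI[OF plane_tree_cyclic[OF assms(1,2) this] assms(3)] show ?thesis .
qed

lemma plane_tree_rot_inj:
  assumes "plane_tree T" "v \<in> verts T" "a \<in> incident T v" "b \<in> incident T v"
  shows "rot T v a = rot T v b \<longleftrightarrow> a = b"
proof -
  have "incident T v \<noteq> {}" using assms(3) by blast
  from inj_on_eq_iff[OF cyclic_on_inj_on[OF plane_tree_cyclic[OF assms(1,2) this]] assms(3,4)]
  show ?thesis .
qed

lemma plane_tree_edge_col:
  assumes "plane_tree T" "e \<in> edges T"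
  shows "\<exists>b w. e = {b, w} \<and> col T b = Some Black \<and> col T w = Some White"
  using assms by (simp add: plane_tree_def)

section \<open>Isomorphisms restrict to branches\<close>

context
  fixes T :: "'v wtree" and T' :: "'w wtree" and \<phi> :: "'v \<Rightarrow> 'w"
  assumes T: "plane_tree T" and T': "plane_tree T'" and iso: "plane_iso \<phi> T T'"
begin

lemma plane_iso_inj: "inj_on \<phi> (verts T)" and plane_iso_verts: "\<phi> ` verts T = verts T'"
  and plane_iso_edges: "(`) \<phi> ` edges T = edges T'"
  using iso by (auto simp: plane_iso_def bij_betw_def)

lemma plane_iso_edge_eq:
  "d \<in> edges T \<Longrightarrow> d' \<in> edges T \<Longrightarrow> \<phi> ` d = \<phi> ` d' \<longleftrightarrow> d = d'"
  using inj_on_image_eq_iff[OF plane_iso_inj] plane_tree_edge_subset[OF T] by blast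

text \<open>Paths avoiding the cut edge are mapped forward, at both ends. Equality then needs no
  inverse isomorphism: the two sides cover the vertices of T, and their images lie in disjoint sides
  of T'.\<close>

lemma plane_iso_branch_verts:
  assumes e: "{v, u} \<in> edges T"
  shows "\<phi> ` branch_verts T v {v, u} = branch_verts T' (\<phi> v) {\<phi> v, \<phi> u}"
proof -
  have sub: "\<phi> x \<in> branch_verts T' (\<phi> w) {\<phi> v, \<phi> u}" if "x \<in> branch_verts T w {v, u}" for x w
  proof -
    have "(w, x) \<in> (adj (edges T - {{v, u}}))\<^sup>*" using that by (simp add: branch_verts_def)
    then have "(\<phi> w, \<phi> x) \<in> (adj (edges T' - {{\<phi> v, \<phi> u}}))\<^sup>*"
    proof (induction rule: rtrancl_induct)
      case (step y z)
      then have yz: "{y, z} \<in> edges T" "{y, z} \<noteq> {v, u}" by auto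
      then have "\<phi> ` {y, z} \<in> edges T'" using plane_iso_edges by blast
      moreover have "\<phi> ` {y, z} \<noteq> \<phi> ` {v, u}" using plane_iso_edge_eq[OF yz(1) e] yz(2) by simp
      ultimately have "(\<phi> y, \<phi> z) \<in> adj (edges T' - {{\<phi> v, \<phi> u}})" by simp
      with step(3) show ?case by (rule rtrancl_into_rtrancl)
    qed simp
    then show ?thesis by (simp add: branch_verts_def)
  qed
  have "\<phi> ` {v, u} \<in> edges T'" using e plane_iso_edges by blast
  then have e': "{\<phi> v, \<phi> u} \<in> edges T'" by simp
  have "z \<in> \<phi> ` branch_verts T v {v, u}" if z: "z \<in> branch_verts T' (\<phi> v) {\<phi> v, \<phi> u}" for z
  proof -
    have "z \<in> \<phi> ` verts T" using z branch_verts_Un[OF T' e'] plane_iso_verts by blast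
    then obtain x where x: "x \<in> verts T" "z = \<phi> x" by blast
    then have "x \<in> branch_verts T v {v, u} \<or> x \<in> branch_verts T u {v, u}"
      using branch_verts_Un[OF T e] by blast
    then show ?thesis
      using x z sub[of x u] branch_verts_disjoint[OF T' e'] by blast
  qed
  then show ?thesis using sub[of _ v] by blast
qed

lemma plane_iso_branch_root:
  assumes e: "{v, u} \<in> edges T"
  shows "branch_root T' (\<phi> v) {\<phi> v, \<phi> u} = map_option ((`) \<phi>) (branch_root T v {v, u})"
proof -
  have v: "v \<in> verts T" and ev: "{v, u} \<in> incident T v"
    using branch_ends(1)[OF T e] e by (auto simp: incident_def)
  then have "rot T' (\<phi> v) (\<phi> ` {v, u}) = \<phi> ` rot T v {v, u}"
    using plane_iso_rot[OF iso] by blast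
  moreover have "rot T v {v, u} \<in> edges T"
    using plane_tree_rot_incident[OF T v ev] by (simp add: incident_def)
  ultimately show ?thesis
    using plane_iso_edge_eq[OF _ e] by (auto simp: branch_root_def)
qed

lemma plane_iso_branch:
  assumes e: "{v, u} \<in> edges T"
  shows "plane_iso \<phi> (branch T v {v, u}) (branch T' (\<phi> v) {\<phi> v, \<phi> u})"
  unfolding plane_iso_def
proof (intro conjI ballI)
  have v: "v \<in> verts T" using branch_ends(1)[OF T e] .
  have B: "branch_verts T v {v, u} \<subseteq> verts T" using branch_verts_Un[OF T e] by blast
  note BV = plane_iso_branch_verts[OF e]
  show "bij_betw \<phi> (verts (branch T v {v, u})) (verts (branch T' (\<phi> v) {\<phi> v, \<phi> u}))"
    using BV inj_on_subset[OF plane_iso_inj B] by (simp add: bij_betw_def)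
  show "(`) \<phi> ` edges (branch T v {v, u}) = edges (branch T' (\<phi> v) {\<phi> v, \<phi> u})"
  proof (intro equalityI subsetI)
    fix d' assume "d' \<in> (`) \<phi> ` edges (branch T v {v, u})"
    then obtain d where d: "d' = \<phi> ` d" "d \<in> edges T" "d \<noteq> {v, u}" "d \<subseteq> branch_verts T v {v, u}"
      by auto
    then have "\<phi> ` d \<noteq> \<phi> ` {v, u}" using plane_iso_edge_eq e by blast
    moreover have "\<phi> ` d \<in> edges T'" using d plane_iso_edges by blast
    ultimately show "d' \<in> edges (branch T' (\<phi> v) {\<phi> v, \<phi> u})" using d BV by auto
  next
    fix d' assume "d' \<in> edges (branch T' (\<phi> v) {\<phi> v, \<phi> u})"
    then have d': "d' \<in> edges T'" "d' \<noteq> \<phi> ` {v, u}" "d' \<subseteq> \<phi> ` branch_verts T v {v, u}"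
      using BV by auto
    then obtain d where d: "d' = \<phi> ` d" "d \<in> edges T" using plane_iso_edges by blast
    have "d \<subseteq> branch_verts T v {v, u}"
    proof
      fix y assume y: "y \<in> d"
      then obtain z where z: "z \<in> branch_verts T v {v, u}" "\<phi> y = \<phi> z" using d' d by blast
      moreover have "y \<in> verts T" using y plane_tree_edge_subset[OF T d(2)] by blast
      ultimately show "y \<in> branch_verts T v {v, u}" using B inj_onD[OF plane_iso_inj, of y z] by blast
    qed
    then show "d' \<in> (`) \<phi> ` edges (branch T v {v, u})" using d d' by auto
  qed
  fix x assume x: "x \<in> verts (branch T v {v, u})"
  then have xT: "x \<in> verts T" using B by auto
  fix d assume d: "d \<in> incident (branch T v {v, u}) x"
  then have dT: "d \<in> incident T x" by (simp add: incident_def)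
  have rd: "rot T x d \<in> edges T"
    using plane_tree_rot_incident[OF T xT dT] by (simp add: incident_def)
  have r: "rot T' (\<phi> x) (\<phi> ` d) = \<phi> ` rot T x d" by (rule plane_iso_rot[OF iso xT dT])
  have re: "rot T' (\<phi> v) {\<phi> v, \<phi> u} = \<phi> ` rot T v {v, u}"
    using plane_iso_rot[OF iso v, of "{v, u}"] e by (simp add: incident_def)
  \<comment> \<open>The rotation of a branch tests whether the next edge is the cut edge;
    injectivity on edges makes this test have the same outcome in both trees.\<close>
  have "\<phi> ` rot T x d = {\<phi> v, \<phi> u} \<longleftrightarrow> rot T x d = {v, u}"
    using plane_iso_edge_eq[OF rd e] by simp
  moreover have "\<phi> x = \<phi> v \<longleftrightarrow> x = v" using inj_on_eq_iff[OF plane_iso_inj xT v] .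
  ultimately show "rot (branch T' (\<phi> v) {\<phi> v, \<phi> u}) (\<phi> x) (\<phi> ` d) = \<phi> ` rot (branch T v {v, u}) x d"
    using r re by auto
next
  fix d assume "d \<in> edges (branch T v {v, u})"
  then show "wt (branch T' (\<phi> v) {\<phi> v, \<phi> u}) (\<phi> ` d) = wt (branch T v {v, u}) d"
    using iso by (simp add: plane_iso_def)
qed

lemma plane_iso_col:
  assumes v: "v \<in> verts T" "col T' (\<phi> v) = col T v" and x: "x \<in> verts T"
  shows "col T' (\<phi> x) = col T x"
  using plane_tree_connected[OF T v(1) x]
proof (induction rule: rtrancl_induct)
  case (step y z)
  then have "{y, z} \<in> edges T" by simp
  then have "\<phi> ` {y, z} \<in> edges T'" using plane_iso_edges by blast
  then have yz': "{\<phi> y, \<phi> z} \<in> edges T'" by simp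
  obtain b w where "{y, z} = {b, w}" "col T b = Some Black" "col T w = Some White"
    using plane_tree_edge_col[OF T \<open>{y, z} \<in> edges T\<close>] by blast
  moreover obtain b' w' where "{\<phi> y, \<phi> z} = {b', w'}" "col T' b' = Some Black" "col T' w' = Some White"
    using plane_tree_edge_col[OF T' yz'] by blast
  ultimately show ?case using step(3) by (auto simp: doubleton_eq_iff)
qed (simp add: v)

end

lemma has_code_plane_iso:
  assumes "dart_tree T v r" "plane_tree T'" "plane_iso \<phi> T T'" "has_code c T v r"
  shows "has_code c T' (\<phi> v) (map_option ((`) \<phi>) r)"
  using assms
proof (induction c arbitrary: T T' v r)
  case Leaf
  then show ?case by simp
next
  case (Node k L R)
  then obtain u where u: "r = Some {v, u}" "u \<noteq> v" "wt T {v, u} = Suc k"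
    and L: "has_code L (branch T u {v, u}) u (branch_root T u {v, u})"
    and R: "has_code R (branch T v {v, u}) v (branch_root T v {v, u})" by auto
  have P: "plane_tree T" and e: "{v, u} \<in> edges T"
    using Node(3) u by (auto simp: dart_tree_def incident_def)
  note P' = Node(4) and iso = Node(5)
  have eu: "{u, v} \<in> edges T" using e by (simp add: insert_commute)
  have "\<phi> ` {v, u} \<in> edges T'" using plane_iso_edges[OF P P' iso] e by blast
  then have e': "{\<phi> v, \<phi> u} \<in> edges T'" by simp
  note D = branch_dart_trees[OF P e] and D' = branch_dart_trees[OF P' e']
  have "has_code L (branch T' (\<phi> u) {\<phi> v, \<phi> u}) (\<phi> u) (branch_root T' (\<phi> u) {\<phi> v, \<phi> u})"
    using Node(1)[OF D(2) _ _ L] D'(2) plane_iso_branch[OF P P' iso eu]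
      plane_iso_branch_root[OF P P' iso eu]
    by (simp add: dart_tree_def insert_commute)
  moreover have "has_code R (branch T' (\<phi> v) {\<phi> v, \<phi> u}) (\<phi> v) (branch_root T' (\<phi> v) {\<phi> v, \<phi> u})"
    using Node(2)[OF D(1) _ _ R] D'(1) plane_iso_branch[OF P P' iso e]
      plane_iso_branch_root[OF P P' iso e]
    by (simp add: dart_tree_def)
  moreover have "\<phi> u \<noteq> \<phi> v" using branch_ends(3)[OF P' e'] by simp
  moreover have "wt T' {\<phi> v, \<phi> u} = Suc k" 
  proof -
    have "wt T' (\<phi> ` {v, u}) = Suc k" using iso e u(3) unfolding plane_iso_def by metis
    then show ?thesis by simp
  qed
  ultimately show ?case using u(1) by auto
qed

text \<open>The rotations of T and of its branch differ only at v, and there only on the cut edge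
  and on the edge before it. The value at the cut edge is the branch root, which \<psi> respects;
  the edge before it is recognised as the one that the branch sends to its root.\<close>

lemma glue_rot:
  fixes T :: "'v wtree" and T' :: "'w wtree"
  assumes T: "plane_tree T" and e: "{v, u} \<in> edges T"
    and T': "plane_tree T'" and e': "{v', u'} \<in> edges T'"
    and \<psi>: "plane_iso \<psi> (branch T v {v, u}) (branch T' v' {v', u'})" "\<psi> v = v'"
    and root: "map_option ((`) \<psi>) (branch_root T v {v, u}) = branch_root T' v' {v', u'}"
    and agree: "\<And>x. x \<in> branch_verts T v {v, u} \<Longrightarrow> \<phi> x = \<psi> x"
    and \<phi>e: "\<phi> ` {v, u} = {v', u'}"
    and x: "x \<in> branch_verts T v {v, u}" and d: "d \<in> incident T x"
  shows "rot T' (\<phi> x) (\<phi> ` d) = \<phi> ` rot T x d"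
proof -
  let ?e = "{v, u}" and ?e' = "{v', u'}"
  let ?B = "branch T v ?e" and ?B' = "branch T' v' ?e'"
  have B: "plane_tree ?B" and B': "plane_tree ?B'"
    using branch_plane_tree[OF T e] branch_plane_tree[OF T' e'] by auto
  have img: "\<phi> ` d = \<psi> ` d" if "d \<in> edges ?B" for d
    using that agree by (intro image_cong) auto
  have xT: "x \<in> verts T" using x branch_verts_Un[OF T e] by blast
  note v = branch_ends(1)[OF T e] and v' = branch_ends(1)[OF T' e']
  have ev: "?e \<in> incident T v" and ev': "?e' \<in> incident T' v'"
    using e e' by (auto simp: incident_def)
  have vB: "v \<in> verts ?B" using branch_verts_self[OF T e] by simp
  have inc: "incident ?B x = incident T x - {?e}" by (rule incident_branch[OF T e x])
  have rB: "rot ?B' (\<psi> x) (\<psi> ` d) = \<psi> ` rot ?B x d" if "d \<noteq> ?e"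
    using plane_iso_rot[OF \<psi>(1), of x d] x d inc that by simp
  have rBe: "rot ?B x d \<in> edges ?B" if "d \<noteq> ?e"
  proof -
    have "rot ?B x d \<in> incident ?B x"
      using inc x d that by (intro plane_tree_rot_incident[OF B]) simp_all
    then show ?thesis unfolding incident_def by blast
  qed
  show ?thesis
  proof (cases "x = v")
    case False
    then have "d \<noteq> ?e" using branch_cut_edge[OF T e x] d by auto
    moreover have "\<psi> x \<noteq> v'"
      using inj_on_eq_iff[OF plane_iso_inj[OF B B' \<psi>(1)], of x v] x vB \<psi>(2) False by simp
    moreover have "d \<in> edges ?B" using d inc \<open>d \<noteq> ?e\<close> by (auto simp: incident_def)
    ultimately show ?thesis
      using rB rBe img agree[OF x] False by (simp del: branch_simps(2))
  next
    case True
    have roote: "\<phi> ` rot T v ?e = rot T' v' ?e'"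
    proof (cases "rot T v ?e = ?e")
      case True
      then show ?thesis using root \<phi>e by (auto simp: branch_root_def split: if_splits)
    next
      case False
      then have "rot T v ?e \<in> edges ?B"
        using branch_dart_tree[OF T e] by (auto simp: branch_root_def dart_tree_def incident_def)
      then show ?thesis
        using img[of "rot T v ?e"] root False by (auto simp: branch_root_def split: if_splits)
    qed
    show ?thesis
    proof (cases "d = ?e")
      case True
      then show ?thesis using roote \<phi>e \<open>x = v\<close> agree[OF x] \<psi>(2) by simp
    next
      case dne: False
      have dB: "d \<in> incident ?B v" using d inc dne \<open>x = v\<close> by auto
      then have dBe: "d \<in> edges ?B" by (simp add: incident_def)
      have dv: "d \<in> incident T v" using d \<open>x = v\<close> by simp
      have "\<phi> ` d \<in> (`) \<psi> ` edges ?B" using dBe img by blast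
      then have d'B: "\<phi> ` d \<in> edges ?B'" using plane_iso_edges[OF B B' \<psi>(1)] by blast
      have "v \<in> d" using dv by (simp add: incident_def)
      moreover have "\<phi> v = v'" using agree[OF x] \<psi>(2) \<open>x = v\<close> by simp
      ultimately have "v' \<in> \<phi> ` d" by blast
      then have d': "\<phi> ` d \<in> incident T' v'" "\<phi> ` d \<noteq> ?e'"
        using d'B by (simp_all add: incident_def)
      note injT = plane_tree_rot_inj[OF T v] and injT' = plane_tree_rot_inj[OF T' v']
      have ne: "rot T v ?e \<noteq> ?e" using rot_fixpoint_incident[OF T e] dv dne by blast
      have re: "rot T v ?e \<in> edges ?B"
        using ne branch_dart_tree[OF T e] by (auto simp: branch_root_def dart_tree_def incident_def)
      have key: "rot ?B' v' (\<phi> ` d) = \<phi> ` rot ?B v d"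
        using rB[OF dne] img[OF dBe] img[OF rBe[OF dne]] \<open>x = v\<close> \<psi>(2)
        by (simp del: branch_simps)
      \<comment> \<open>In the branch, the predecessor of the cut edge is sent to the successor of
        the cut edge. If only one of d and its image preceded the cut edge in its tree, then in the
        other tree this edge and the cut edge would have the same successor, against injectivity of
        the rotation.\<close>
      have "rot T v d = ?e \<longleftrightarrow> rot T' v' (\<phi> ` d) = ?e'"
      proof
        assume a: "rot T v d = ?e"
        show "rot T' v' (\<phi> ` d) = ?e'"
        proof (rule ccontr)
          assume "rot T' v' (\<phi> ` d) \<noteq> ?e'"
          then have "rot T' v' (\<phi> ` d) = rot T' v' ?e'" using key a roote by simp
          then show False using injT' d' ev' by blast
        qed
      next
        assume a: "rot T' v' (\<phi> ` d) = ?e'"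
        show "rot T v d = ?e"
        proof (rule ccontr)
          assume b: "rot T v d \<noteq> ?e"
          then have "\<phi> ` rot T v d = \<phi> ` rot T v ?e" using key a roote by simp
          moreover have rd: "rot T v d \<in> edges ?B" using rBe[OF dne] b \<open>x = v\<close> by simp
          ultimately have "rot T v d = rot T v ?e"
            using img[OF rd] img[OF re] plane_iso_edge_eq[OF B B' \<psi>(1) rd re] by blast
          then show False using injT[OF dv ev] dne by blast
        qed
      qed
      then have "rot T' v' (\<phi> ` d) = \<phi> ` rot T v d"
        using key \<phi>e by (cases "rot T v d = ?e") simp_all
      then show ?thesis using \<open>x = v\<close> agree[OF x] \<psi>(2) by simp
    qed
  qed
qed

text \<open>The isomorphisms of the two branches act on disjoint sets of vertices that cover the
  tree, and they send the ends of the root edge to the ends of the other root edge. So they combine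
  to one map; the two uses of \<open>glue_rot\<close>, with the ends exchanged, give compatibility
  with the rotations.\<close>

lemma has_code_imp_plane_iso:
  fixes T :: "'v wtree" and T' :: "'w wtree"
  assumes "dart_tree T v r" "dart_tree T' v' r'" "has_code c T v r" "has_code c T' v' r'"
  shows "\<exists>\<phi>. plane_iso \<phi> T T' \<and> \<phi> v = v' \<and> map_option ((`) \<phi>) r = r'"
  using assms
proof (induction c arbitrary: T T' v v' r r')
  case Leaf
  have P: "plane_tree T" "v \<in> verts T" "edges T = {}" "plane_tree T'" "v' \<in> verts T'" "edges T' = {}"
    using Leaf by (simp_all add: dart_tree_def)
  then have "verts T = {v}" "verts T' = {v'}"
    using plane_tree_no_incident(2) by (metis (no_types, lifting) empty_Collect_eq empty_iff incident_def)+
  then show ?case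
    using P Leaf by (intro exI[of _ "\<lambda>_. v'"]) (auto simp: plane_iso_def incident_def bij_betw_def)
next
  case (Node k L R)
  from Node(5) obtain u where u: "r = Some {v, u}" "u \<noteq> v" "wt T {v, u} = Suc k"
    and L: "has_code L (branch T u {v, u}) u (branch_root T u {v, u})"
    and R: "has_code R (branch T v {v, u}) v (branch_root T v {v, u})" by auto
  from Node(6) obtain u' where u': "r' = Some {v', u'}" "u' \<noteq> v'" "wt T' {v', u'} = Suc k"
    and L': "has_code L (branch T' u' {v', u'}) u' (branch_root T' u' {v', u'})"
    and R': "has_code R (branch T' v' {v', u'}) v' (branch_root T' v' {v', u'})" by auto
  let ?e = "{v, u}" and ?e' = "{v', u'}"
  have P: "plane_tree T" and e: "?e \<in> edges T" and P': "plane_tree T'" and e': "?e' \<in> edges T'"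
    using Node(3,4) u u' by (auto simp: dart_tree_def incident_def)
  have es: "{u, v} \<in> edges T" "{u', v'} \<in> edges T'" using e e' by (simp_all add: insert_commute)
  note D = branch_dart_trees[OF P e] and D' = branch_dart_trees[OF P' e']
  obtain \<alpha> where \<alpha>: "plane_iso \<alpha> (branch T u ?e) (branch T' u' ?e')" "\<alpha> u = u'"
      "map_option ((`) \<alpha>) (branch_root T u ?e) = branch_root T' u' ?e'"
    using Node(1)[OF D(2) D'(2) L L'] by blast
  obtain \<beta> where \<beta>: "plane_iso \<beta> (branch T v ?e) (branch T' v' ?e')" "\<beta> v = v'"
      "map_option ((`) \<beta>) (branch_root T v ?e) = branch_root T' v' ?e'"
    using Node(2)[OF D(1) D'(1) R R'] by blast
  let ?Bv = "branch_verts T v ?e" and ?Bu = "branch_verts T u ?e"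
  define \<phi> where "\<phi> x = (if x \<in> ?Bv then \<beta> x else \<alpha> x)" for x
  have \<phi>v: "\<phi> x = \<beta> x" if "x \<in> ?Bv" for x using that by (simp add: \<phi>_def)
  have \<phi>u: "\<phi> x = \<alpha> x" if "x \<in> ?Bu" for x
    using that branch_verts_disjoint[OF P e] by (auto simp: \<phi>_def)
  have v: "\<phi> v = v'" using \<phi>v branch_verts_self[OF P e] \<beta>(2) by blast
  have "u \<in> ?Bu" by (simp add: branch_verts_def)
  then have uu: "\<phi> u = u'" using \<phi>u \<alpha>(2) by metis
  then have \<phi>e: "\<phi> ` ?e = ?e'" using v by simp
  have "plane_iso \<phi> T T'"
    unfolding plane_iso_def
  proof (intro conjI ballI)
    have "bij_betw \<phi> ?Bv (branch_verts T' v' ?e')"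
      using \<beta>(1) bij_betw_cong[of ?Bv \<phi> \<beta>] \<phi>v by (simp add: plane_iso_def)
    moreover have "bij_betw \<phi> ?Bu (branch_verts T' u' ?e')"
      using \<alpha>(1) bij_betw_cong[of ?Bu \<phi> \<alpha>] \<phi>u by (simp add: plane_iso_def)
    ultimately have "bij_betw \<phi> (?Bv \<union> ?Bu) (branch_verts T' v' ?e' \<union> branch_verts T' u' ?e')"
      using branch_verts_disjoint[OF P' e'] by (intro bij_betw_combine)
    then show "bij_betw \<phi> (verts T) (verts T')"
      using branch_verts_Un[OF P e] branch_verts_Un[OF P' e'] by simp
    have imv: "\<phi> ` d = \<beta> ` d" if "d \<in> edges (branch T v ?e)" for d
      using that \<phi>v by (intro image_cong) auto
    have imu: "\<phi> ` d = \<alpha> ` d" if "d \<in> edges (branch T u ?e)" for d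
      using that \<phi>u by (intro image_cong) auto
    have ev: "(`) \<phi> ` edges (branch T v ?e) = edges (branch T' v' ?e')"
      using \<beta>(1) imv by (simp add: plane_iso_def cong: image_cong_simp del: branch_simps)
    have eu: "(`) \<phi> ` edges (branch T u ?e) = edges (branch T' u' ?e')"
      using \<alpha>(1) imu by (simp add: plane_iso_def cong: image_cong_simp del: branch_simps)
    show "(`) \<phi> ` edges T = edges T'"
      by (simp only: branch_edges(1)[OF P e] branch_edges(1)[OF P' e'] image_Un image_insert[of "(`) \<phi>"] \<phi>e ev eu)
    show "wt T' (\<phi> ` d) = wt T d" if dE: "d \<in> edges T" for d
    proof -
      consider "d = ?e" | "d \<in> edges (branch T v ?e)" | "d \<in> edges (branch T u ?e)"
        using branch_edges(1)[OF P e] dE by blast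
      then show ?thesis
      proof cases
        case 1
        then show ?thesis using u u' \<phi>e by simp
      next
        case 2
        then have "wt (branch T' v' ?e') (\<beta> ` d) = wt (branch T v ?e) d"
          using \<beta>(1) unfolding plane_iso_def by blast
        then show ?thesis using imv[OF 2] by simp
      next
        case 3
        then have "wt (branch T' u' ?e') (\<alpha> ` d) = wt (branch T u ?e) d"
          using \<alpha>(1) unfolding plane_iso_def by blast
        then show ?thesis using imu[OF 3] by simp
      qed
    qed
    fix x d assume x: "x \<in> verts T" and d: "d \<in> incident T x"
    consider "x \<in> ?Bv" | "x \<in> ?Bu" using branch_verts_Un[OF P e] x by blast
    then show "rot T' (\<phi> x) (\<phi> ` d) = \<phi> ` rot T x d"
    proof cases
      case 1
      then show ?thesis using glue_rot[OF P e P' e' \<beta> \<phi>v \<phi>e _ d] by blast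
    next
      case 2
      have "{u, v} = ?e" "{u', v'} = ?e'" by auto
      then show ?thesis
        using glue_rot[OF P es(1) P' es(2), of \<alpha> \<phi> x d] \<alpha> \<phi>u \<phi>e d 2 by simp
    qed
  qed
  then show ?case using v u u' \<phi>e by auto
qed

section \<open>Every code is realised\<close>

text \<open>The new edge \<open>e\<close> is inserted immediately before the old root \<open>r1\<close> in the cyclic order
  around \<open>v1\<close>, so that cutting \<open>e\<close> recovers \<open>r1\<close> as the branch root.\<close>

definition is_half :: "'v wtree \<Rightarrow> 'v wtree \<Rightarrow> 'v \<Rightarrow> 'v set option \<Rightarrow> 'v set \<Rightarrow> bool" where
  "is_half T T1 v1 r1 e \<longleftrightarrow>
     (\<forall>x\<in>verts T1. col T x = col T1 x) \<and>
     (\<forall>d\<in>edges T1. wt T d = wt T1 d) \<and>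
     (\<forall>x\<in>verts T1. \<forall>d\<in>incident T1 x.
        rot T x d = (if x = v1 \<and> r1 = Some (rot T1 v1 d) then e else rot T1 x d)) \<and>
     rot T v1 e = (case r1 of None \<Rightarrow> e | Some r \<Rightarrow> r)"

text \<open>A specification symmetric in the two halves, separate from the construction that
  satisfies it: facts proved about \<open>T1\<close> transfer to \<open>T2\<close> by
  \<open>is_join_sym\<close>. The base vertices must have opposite colours for the new edge to be
  legal.\<close>

definition is_join ::
    "'v wtree \<Rightarrow> 'v wtree \<Rightarrow> 'v \<Rightarrow> 'v set option \<Rightarrow> 'v wtree \<Rightarrow> 'v \<Rightarrow> 'v set option \<Rightarrow> bool" where
  "is_join T T1 v1 r1 T2 v2 r2 \<longleftrightarrow>
     dart_tree T1 v1 r1 \<and> dart_tree T2 v2 r2 \<and>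
     {col T1 v1, col T2 v2} = {Some Black, Some White} \<and>
     verts T1 \<inter> verts T2 = {} \<and> verts T = verts T1 \<union> verts T2 \<and>
     edges T = insert {v1, v2} (edges T1 \<union> edges T2) \<and> wt T {v1, v2} > 0 \<and>
     is_half T T1 v1 r1 {v1, v2} \<and> is_half T T2 v2 r2 {v1, v2}"

lemma is_join_sym: "is_join T T1 v1 r1 T2 v2 r2 \<Longrightarrow> is_join T T2 v2 r2 T1 v1 r1"
  unfolding is_join_def by (simp add: insert_commute Un_commute Int_commute)

section \<open>Cutting the joining edge recovers each half\<close>

context
  fixes T T1 T2 :: "'v wtree" and v1 v2 :: 'v and r1 r2 :: "'v set option"
  assumes J: "is_join T T1 v1 r1 T2 v2 r2"
begin

lemma join_parts:
  shows join_P1: "plane_tree T1" and join_P2: "plane_tree T2"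
    and join_v1: "v1 \<in> verts T1" and join_v2: "v2 \<in> verts T2"
    and join_disjoint: "verts T1 \<inter> verts T2 = {}"
    and join_verts: "verts T = verts T1 \<union> verts T2"
    and join_edges: "edges T = insert {v1, v2} (edges T1 \<union> edges T2)"
    and join_half: "is_half T T1 v1 r1 {v1, v2}"
  using J by (auto simp: is_join_def dart_tree_def)

lemma join_edge1:
  assumes "d \<in> edges T1"
  shows "d \<subseteq> verts T1" "d \<noteq> {v1, v2}"
  using plane_tree_edge_subset[OF join_P1 assms] join_v2 join_disjoint by auto

lemma join_edge_at:
  assumes "d \<in> edges T" "d \<noteq> {v1, v2}" "x \<in> d" "x \<in> verts T1"
  shows "d \<in> edges T1"
proof -
  have "d \<notin> edges T2"
    using plane_tree_edge_subset[OF join_P2, of d] assms join_disjoint by blast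
  then show ?thesis using assms join_edges by blast
qed

lemma join_branch_verts: "branch_verts T v1 {v1, v2} = verts T1"
proof (intro equalityI subsetI)
  fix x assume "x \<in> branch_verts T v1 {v1, v2}"
  then have "(v1, x) \<in> (adj (edges T - {{v1, v2}}))\<^sup>*" by (simp add: branch_verts_def)
  then show "x \<in> verts T1"
  proof (induction rule: rtrancl_induct)
    case (step y z)
    then have "{y, z} \<in> edges T1" by (intro join_edge_at[of _ y]) auto
    then show ?case using join_edge1 by blast
  qed (rule join_v1)
next
  fix x assume "x \<in> verts T1"
  then have "(v1, x) \<in> (adj (edges T1))\<^sup>*"
    using plane_tree_connected[OF join_P1 join_v1] by blast
  then show "x \<in> branch_verts T v1 {v1, v2}"
    unfolding branch_verts_def using join_edge1(2) join_edges
    by (auto elim!: adj_rtrancl_mono)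
qed

lemma join_branch_edges: "edges (branch T v1 {v1, v2}) = edges T1"
proof (intro equalityI subsetI)
  fix d assume "d \<in> edges (branch T v1 {v1, v2})"
  then have d: "d \<in> edges T" "d \<noteq> {v1, v2}" "d \<subseteq> verts T1"
    by (simp_all add: join_branch_verts)
  have "d \<noteq> {}" using d(1) join_edges plane_tree_edge_card[OF join_P1, of d]
      plane_tree_edge_card[OF join_P2, of d] by auto
  then show "d \<in> edges T1" using join_edge_at[of d] d by blast
next
  fix d assume "d \<in> edges T1"
  then show "d \<in> edges (branch T v1 {v1, v2})"
    using join_edge1[of d] join_edges by (simp add: join_branch_verts)
qed

lemma join_branch_root: "branch_root T v1 {v1, v2} = r1"
proof (cases r1)
  case None
  then show ?thesis using join_half by (simp add: is_half_def branch_root_def)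
next
  case (Some r)
  then have "r \<in> edges T1" using J by (simp add: is_join_def dart_tree_def incident_def)
  then show ?thesis
    using join_half Some join_edge1(2) by (auto simp: is_half_def branch_root_def)
qed

lemma join_branch_iso: "plane_iso id T1 (branch T v1 {v1, v2})"
  unfolding plane_iso_def
proof (intro conjI ballI)
  show "bij_betw id (verts T1) (verts (branch T v1 {v1, v2}))"
    by (simp add: join_branch_verts)
  show "(`) id ` edges T1 = edges (branch T v1 {v1, v2})"
    unfolding join_branch_edges by simp
  show "wt (branch T v1 {v1, v2}) (id ` d) = wt T1 d" if "d \<in> edges T1" for d
    using join_half that by (simp add: is_half_def)
  fix x d assume x: "x \<in> verts T1" and d: "d \<in> incident T1 x"
  have rd: "rot T1 x d \<in> edges T1"
    using plane_tree_rot_incident[OF join_P1 x d] by (simp add: incident_def)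
  have "rot T x d = (if x = v1 \<and> r1 = Some (rot T1 v1 d) then {v1, v2} else rot T1 x d)"
    using join_half x d unfolding is_half_def by blast
  moreover have "rot T v1 {v1, v2} = (case r1 of None \<Rightarrow> {v1, v2} | Some r \<Rightarrow> r)"
    using join_half unfolding is_half_def by blast
  ultimately have "rot (branch T v1 {v1, v2}) x d = rot T1 x d"
    using join_edge1(2)[OF rd] by (auto split: if_splits)
  then show "rot (branch T v1 {v1, v2}) (id x) (id ` d) = id ` rot T1 x d"
    by (simp del: branch_simps)
qed

text \<open>A detour through the other half can leave and re-enter \<open>T1\<close> only at
  \<open>v1\<close>, so it cannot connect what is separated within \<open>T1\<close>.\<close>

lemma join_bridge_half:
  assumes xy: "{x, y} \<in> edges T1"
  shows "(x, y) \<notin> (adj (edges T - {{x, y}}))\<^sup>*"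
proof
  assume "(x, y) \<in> (adj (edges T - {{x, y}}))\<^sup>*"
  moreover have x: "x \<in> verts T1" and y: "y \<in> verts T1" using join_edge1(1)[OF xy] by auto
  \<comment> \<open>contract the other half to \<open>v1\<close>\<close>
  have "(x, if z \<in> verts T1 then z else v1) \<in> (adj (edges T1 - {{x, y}}))\<^sup>*"
    if "(x, z) \<in> (adj (edges T - {{x, y}}))\<^sup>*" for z
    using that
  proof (induction rule: rtrancl_induct)
    case base
    show ?case using x by simp
  next
    case (step z z')
    then have zz': "{z, z'} \<in> edges T" "{z, z'} \<noteq> {x, y}" by auto
    show ?case
    proof (cases "{z, z'} = {v1, v2}")
      case True
      then have "(if z \<in> verts T1 then z else v1) = v1" "(if z' \<in> verts T1 then z' else v1) = v1"
        using join_v2 join_disjoint by (auto simp: doubleton_eq_iff)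
      then show ?thesis using step(3) by (simp only:)
    next
      case False
      show ?thesis
      proof (cases "{z, z'} \<in> edges T1")
        case True
        then have "z \<in> verts T1" "z' \<in> verts T1" using join_edge1(1)[OF True] by auto
        moreover have "(z, z') \<in> adj (edges T1 - {{x, y}})" using True zz' by simp
        ultimately show ?thesis using step(3) rtrancl_into_rtrancl[of x z _ z'] by simp
      next
        case F: False
        then have "z \<notin> verts T1" "z' \<notin> verts T1"
          using join_edge_at[OF zz'(1) False, of z] join_edge_at[OF zz'(1) False, of z'] F by auto
        then show ?thesis using step(3) by simp
      qed
    qed
  qed
  from this[of y] have "(x, y) \<in> (adj (edges T - {{x, y}}))\<^sup>* \<Longrightarrow> (x, y) \<in> (adj (edges T1 - {{x, y}}))\<^sup>*"
    using y by simp
  ultimately show False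
    using plane_tree_bridges[OF join_P1] xy unfolding all_bridges_def by blast
qed

lemma join_cyclic:
  assumes x: "x \<in> verts T1" and ne: "incident T x \<noteq> {}"
  shows "cyclic_on (rot T x) (incident T x)"
proof -
  have rot: "rot T x d = (if x = v1 \<and> r1 = Some (rot T1 v1 d) then {v1, v2} else rot T1 x d)"
    if "d \<in> incident T1 x" for d
    using join_half x that unfolding is_half_def by blast
  have rote: "rot T v1 {v1, v2} = (case r1 of None \<Rightarrow> {v1, v2} | Some r \<Rightarrow> r)"
    using join_half unfolding is_half_def by blast
  have inc: "incident T x = (if x = v1 then insert {v1, v2} (incident T1 x) else incident T1 x)"
  proof -
    have "x \<noteq> v2" using x join_v2 join_disjoint by blast
    then show ?thesis
      using join_edge_at[of _ x] x join_edges by (auto simp: incident_def)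
  qed
  show ?thesis
  proof (cases "x = v1")
    case False
    then have "incident T1 x \<noteq> {}" using inc ne by simp
    \<comment> \<open>With \<open>id\<close> as the map, \<open>cyclic_on_image\<close> acts as a
      congruence rule: the two rotations agree on the edges at x.\<close>
    from cyclic_on_image[OF plane_tree_cyclic[OF join_P1 x this], of "rot T x" id] 
    show ?thesis using False inc rot by simp
  next
    case True
    show ?thesis
    proof (cases r1)
      case None
      then have "incident T1 x = {}" using J by (simp add: is_join_def dart_tree_def incident_def)
      then have "incident T x = {{v1, v2}}" using inc True by simp
      moreover have "rot T x {v1, v2} = {v1, v2}" using rote None True by simp
      ultimately show ?thesis
        using orbit.base[of "rot T x" "{v1, v2}"] by (intro cyclic_onI_reach) simp_all
    next
      case (Some r)
      then have r: "r \<in> incident T1 x" using J True by (simp add: is_join_def dart_tree_def)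
      then have ne1: "incident T1 x \<noteq> {}" by blast
      have "{v1, v2} \<notin> incident T1 x" using join_edge1(2) by (auto simp: incident_def)
      from cyclic_on_insert[OF plane_tree_cyclic[OF join_P1 x ne1] this r, of "rot T x"]
      show ?thesis using rot rote Some True inc by auto
    qed
  qed
qed

end

lemma join_plane_tree:
  assumes J: "is_join T T1 v1 r1 T2 v2 r2"
  shows "plane_tree T"
  unfolding plane_tree_def finite_tree_iff
proof (intro conjI ballI impI)
  note S = is_join_sym[OF J]
  note P1 = join_P1[OF J] and P2 = join_P2[OF J] and v1 = join_v1[OF J] and v2 = join_v2[OF J]
  note V = join_verts[OF J] and E = join_edges[OF J]
  have ne: "v1 \<noteq> v2" using v1 v2 join_disjoint[OF J] by blast
  show "finite (verts T)" using V plane_tree_finite[OF P1] plane_tree_finite[OF P2] by simp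
  have E_cases: "d = {v1, v2} \<or> d \<in> edges T1 \<or> d \<in> edges T2" if "d \<in> edges T" for d
    using that E by simp
  show "d \<subseteq> verts T" if "d \<in> edges T" for d
    using E_cases[OF that] plane_tree_edge_subset[OF P1, of d] plane_tree_edge_subset[OF P2, of d]
    by (elim disjE) (auto simp: V v1 v2)
  show "card d = 2" if "d \<in> edges T" for d
    using E_cases[OF that] plane_tree_edge_card[OF P1, of d] plane_tree_edge_card[OF P2, of d] ne
    by (elim disjE) simp_all
  have sub: "edges T1 \<subseteq> edges T" "edges T2 \<subseteq> edges T" using E by auto
  have reach: "(v1, x) \<in> (adj (edges T))\<^sup>*" if "x \<in> verts T" for x
  proof (cases "x \<in> verts T1")
    case True
    from adj_rtrancl_mono[OF plane_tree_connected[OF P1 v1 True] sub(1)] show ?thesis .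
  next
    case False
    then have "x \<in> verts T2" using that V by simp
    from adj_rtrancl_mono[OF plane_tree_connected[OF P2 v2 this] sub(2)]
    have "(v2, x) \<in> (adj (edges T))\<^sup>*" .
    moreover have "(v1, v2) \<in> adj (edges T)" using E by simp
    ultimately show ?thesis by (rule converse_rtrancl_into_rtrancl[rotated])
  qed
  have "(x, y) \<in> (adj (edges T))\<^sup>*" if "x \<in> verts T" "y \<in> verts T" for x y
    by (rule rtrancl_trans[OF adj_rtrancl_sym[OF reach[OF that(1)]] reach[OF that(2)]])
  moreover have "verts T \<noteq> {}" using v1 V by blast
  ultimately show "connected_graph (verts T) (edges T)" unfolding connected_graph_adj by blast
  show "all_bridges (edges T)"
    unfolding all_bridges_def
  proof (intro allI impI)
    fix x y assume "{x, y} \<in> edges T"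
    then consider "{x, y} = {v1, v2}" | "{x, y} \<in> edges T1" | "{x, y} \<in> edges T2"
      using E_cases by blast
    then show "(x, y) \<notin> (adj (edges T - {{x, y}}))\<^sup>*"
    proof cases
      case 1
      have "v2 \<notin> branch_verts T v1 {v1, v2}"
        using join_branch_verts[OF J] v2 join_disjoint[OF J] by blast
      then have *: "(v1, v2) \<notin> (adj (edges T - {{v1, v2}}))\<^sup>*" by (simp add: branch_verts_def)
      then have "(v2, v1) \<notin> (adj (edges T - {{v1, v2}}))\<^sup>*" 
        using adj_rtrancl_sym[of v2 v1] by blast
      from 1 have "x = v1 \<and> y = v2 \<or> x = v2 \<and> y = v1" by (simp only: doubleton_eq_iff)
      then show ?thesis
        using * \<open>(v2, v1) \<notin> _\<close> by (elim disjE) (simp_all add: insert_commute)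
    next
      case 2
      show ?thesis by (rule join_bridge_half[OF J 2])
    next
      case 3
      show ?thesis by (rule join_bridge_half[OF S 3])
    qed
  qed
  have c1: "col T x = col T1 x" if "x \<in> verts T1" for x
    using join_half[OF J] that by (simp add: is_half_def)
  have c2: "col T x = col T2 x" if "x \<in> verts T2" for x
    using join_half[OF S] that by (simp add: is_half_def)
  show "\<exists>b w. d = {b, w} \<and> col T b = Some Black \<and> col T w = Some White" if "d \<in> edges T" for d
  proof -
    consider "d = {v1, v2}" | "d \<in> edges T1" | "d \<in> edges T2" using E_cases \<open>d \<in> edges T\<close> by blast
    then show ?thesis
    proof cases
      case 1
      have "{col T v1, col T v2} = {Some Black, Some White}"
        using J v1 v2 c1 c2 by (simp add: is_join_def)
      then have "col T v1 = Some Black \<and> col T v2 = Some White \<or>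
          col T v2 = Some Black \<and> col T v1 = Some White" by (auto simp: doubleton_eq_iff)
      then show ?thesis using 1 by (auto simp: insert_commute)
    next
      case 2
      from plane_tree_edge_col[OF P1 2] obtain b w
        where bw: "d = {b, w}" "col T1 b = Some Black" "col T1 w = Some White" by blast
      then have "b \<in> verts T1" "w \<in> verts T1" using plane_tree_edge_subset[OF P1 2] by simp_all
      then show ?thesis using bw c1 by (intro exI[of _ b] exI[of _ w]) simp
    next
      case 3
      from plane_tree_edge_col[OF P2 3] obtain b w
        where bw: "d = {b, w}" "col T2 b = Some Black" "col T2 w = Some White" by blast
      then have "b \<in> verts T2" "w \<in> verts T2" using plane_tree_edge_subset[OF P2 3] by simp_all
      then show ?thesis using bw c2 by (intro exI[of _ b] exI[of _ w]) simp
    qed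
  qed
  show "wt T d > 0" if "d \<in> edges T" for d
  proof -
    consider "d = {v1, v2}" | "d \<in> edges T1" | "d \<in> edges T2" using E_cases \<open>d \<in> edges T\<close> by blast
    then show ?thesis
    proof cases
      case 1
      then show ?thesis using J by (simp add: is_join_def)
    next
      case 2
      then show ?thesis using join_half[OF J] plane_tree_wt[OF P1] by (simp add: is_half_def)
    next
      case 3
      then show ?thesis using join_half[OF S] plane_tree_wt[OF P2] by (simp add: is_half_def)
    qed
  qed
  fix x assume "x \<in> verts T" and "incident T x \<noteq> {}"
  then show "cyclic_on (rot T x) (incident T x)"
    using V join_cyclic[OF J, of x] join_cyclic[OF S, of x] by blast
qed

text \<open>The base vertex of the join is \<open>v2\<close>, so the first tree is the far side and
  supplies the left subtree.\<close>

lemma join_has_code: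
  assumes J: "is_join T T1 v1 r1 T2 v2 r2" and w: "wt T {v1, v2} = Suc k"
    and c: "has_code L T1 v1 r1" "has_code R T2 v2 r2"
  shows "dart_tree T v2 (Some {v1, v2})" "has_code (Node k L R) T v2 (Some {v1, v2})"
proof -
  note S = is_join_sym[OF J]
  have P: "plane_tree T" by (rule join_plane_tree[OF J])
  have e: "{v1, v2} \<in> edges T" "{v2, v1} \<in> edges T"
    using join_edges[OF J] by (auto simp: insert_commute)
  have "v2 \<in> verts T" using join_verts[OF J] join_v2[OF J] by blast
  then show "dart_tree T v2 (Some {v1, v2})" using P e by (simp add: dart_tree_def incident_def)
  have D: "dart_tree T1 v1 r1" "dart_tree T2 v2 r2" using J by (auto simp: is_join_def)
  have "has_code L (branch T v1 {v1, v2}) v1 (branch_root T v1 {v1, v2})"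
    using has_code_plane_iso[OF D(1) branch_plane_tree[OF P e(1)] join_branch_iso[OF J] c(1)]
      join_branch_root[OF J] by (cases r1) simp_all
  moreover have "has_code R (branch T v2 {v2, v1}) v2 (branch_root T v2 {v2, v1})"
    using has_code_plane_iso[OF D(2) branch_plane_tree[OF P e(2)] join_branch_iso[OF S] c(2)]
      join_branch_root[OF S] by (cases r2) simp_all
  moreover have "v1 \<noteq> v2" using branch_ends(3)[OF P e(1)] .
  ultimately show "has_code (Node k L R) T v2 (Some {v1, v2})"
    using w by (auto simp: insert_commute intro!: exI[of _ v1])
qed

definition half_rot :: "'v wtree \<Rightarrow> 'v \<Rightarrow> 'v set option \<Rightarrow> 'v set \<Rightarrow> 'v \<Rightarrow> 'v set \<Rightarrow> 'v set" where
  "half_rot T v r e x d =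
     (if x = v \<and> d = e then (case r of None \<Rightarrow> e | Some r' \<Rightarrow> r')
      else if x = v \<and> r = Some (rot T v d) then e else rot T x d)"

lemma is_join_exists:
  assumes "dart_tree T1 v1 r1" "dart_tree T2 v2 r2"
    and "{col T1 v1, col T2 v2} = {Some Black, Some White}" "verts T1 \<inter> verts T2 = {}"
  shows "\<exists>T. is_join T T1 v1 r1 T2 v2 r2 \<and> wt T {v1, v2} = Suc k"
proof -
  let ?e = "{v1, v2}"
  define T where "T = \<lparr>verts = verts T1 \<union> verts T2,
    edges = insert ?e (edges T1 \<union> edges T2),
    col = \<lambda>x. if x \<in> verts T1 then col T1 x else col T2 x,
    rot = \<lambda>x d. if x \<in> verts T1 then half_rot T1 v1 r1 ?e x d else half_rot T2 v2 r2 ?e x d,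
    wt = \<lambda>d. if d = ?e then Suc k else if d \<in> edges T1 then wt T1 d else wt T2 d\<rparr>"
  have P: "plane_tree T1" "plane_tree T2" and v: "v1 \<in> verts T1" "v2 \<in> verts T2"
    using assms by (auto simp: dart_tree_def)
  have E1: "d \<subseteq> verts T1 \<and> d \<noteq> {}" if "d \<in> edges T1" for d
    using plane_tree_edge_subset[OF P(1) that] plane_tree_edge_card[OF P(1) that] by auto
  have E2: "d \<subseteq> verts T2 \<and> d \<noteq> {}" if "d \<in> edges T2" for d
    using plane_tree_edge_subset[OF P(2) that] plane_tree_edge_card[OF P(2) that] by auto
  have e: "?e \<notin> edges T1" "?e \<notin> edges T2" using E1[of ?e] E2[of ?e] v assms(4) by auto
  have dis: "d \<notin> edges T1" if "d \<in> edges T2" for d using E1[of d] E2[OF that] assms(4) by blast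
  have out: "x \<notin> verts T1" if "x \<in> verts T2" for x using that assms(4) by blast
  have "is_half T T1 v1 r1 ?e"
    using e v unfolding is_half_def by (auto simp: T_def half_rot_def incident_def)
  moreover have "is_half T T2 v2 r2 ?e"
    using e v dis out unfolding is_half_def by (auto simp: T_def half_rot_def incident_def)
  ultimately have "is_join T T1 v1 r1 T2 v2 r2"
    unfolding is_join_def using assms by (simp add: T_def)
  then show ?thesis by (intro exI[of _ T]) (simp add: T_def)
qed

text \<open>The statement is strengthened for the induction: the two halves need base vertices of
  opposite colours, hence an arbitrary colour \<kappa>, and disjoint vertex sets, hence the set F to
  be avoided.\<close>

lemma has_code_realised:
  fixes F :: "nat set"
  assumes "finite F"
  shows "\<exists>T v r. dart_tree T v r \<and> has_code c T v r \<and> col T v = Some \<kappa> \<and> verts T \<inter> F = {}"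
  using assms
proof (induction c arbitrary: \<kappa> F)
  case Leaf
  then obtain v where v: "v \<notin> F" using ex_new_if_finite[OF infinite_UNIV_nat] by blast
  define T :: "nat wtree" where
    "T = \<lparr>verts = {v}, edges = {}, col = \<lambda>_. Some \<kappa>, rot = \<lambda>_ d. d, wt = \<lambda>_. 1\<rparr>"
  have "dart_tree T v None"
    by (simp add: T_def dart_tree_def plane_tree_def finite_tree_iff connected_graph_adj
        all_bridges_def incident_def)
  then show ?case using v by (intro exI[of _ T] exI[of _ v] exI[of _ None]) (simp add: T_def)
next
  case (Node k L R)
  obtain \<kappa>' where \<kappa>: "{Some \<kappa>', Some \<kappa>} = {Some Black, Some White}"
    by (cases \<kappa>) blast+
  obtain T1 :: "nat wtree" and v1 r1 where T1: "dart_tree T1 v1 r1" "has_code L T1 v1 r1"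
      "col T1 v1 = Some \<kappa>'" "verts T1 \<inter> F = {}"
    using Node(1)[OF Node(3)] by blast
  have "finite (F \<union> verts T1)"
    using Node(3) T1(1) plane_tree_finite unfolding dart_tree_def by blast
  then obtain T2 :: "nat wtree" and v2 r2 where T2: "dart_tree T2 v2 r2" "has_code R T2 v2 r2"
      "col T2 v2 = Some \<kappa>" "verts T2 \<inter> (F \<union> verts T1) = {}"
    using Node(2) by blast
  have dis: "verts T1 \<inter> verts T2 = {}" using T2(4) by blast
  obtain T where T: "is_join T T1 v1 r1 T2 v2 r2" "wt T {v1, v2} = Suc k"
    using is_join_exists[OF T1(1) T2(1) _ dis] \<kappa> T1(3) T2(3) by metis
  have "col T v2 = Some \<kappa>"
    using join_half[OF is_join_sym[OF T(1)]] join_v2[OF T(1)] T2(3) by (simp add: is_half_def)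
  moreover have "verts T \<inter> F = {}" using join_verts[OF T(1)] T1(4) T2(4) by blast
  ultimately show ?case using join_has_code[OF T T1(2) T2(2)] by blast
qed

section \<open>Counting isomorphism classes by codes\<close>

lemma wbp_tree_iff:
  "wbp_tree T \<longleftrightarrow> plane_tree T \<and> (edges T = {} \<longrightarrow> (\<forall>v\<in>verts T. col T v = None))"
  unfolding wbp_tree_def plane_tree_def by blast

lemma plane_tree_black_end:
  assumes "plane_tree T" "e \<in> edges T"
  shows "\<exists>!v. v \<in> e \<and> col T v = Some Black"
  using plane_tree_edge_col[OF assms] by auto

lemma wbp_tree_dart_tree:
  assumes "wbp_tree T" "e \<in> edges T" "v \<in> e"
  shows "dart_tree T v (Some e)"
  using assms plane_tree_edge_subset[of T e] by (auto simp: wbp_tree_iff dart_tree_def incident_def)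

text \<open>The black end of the root edge serves as base vertex. The description is well defined
  because an edge has exactly one black end and a \<open>dart_tree\<close> exactly one code.\<close>

definition rooted_code :: "'v wtree \<times> 'v set option \<Rightarrow> btree" where
  "rooted_code = (\<lambda>(T, r). case r of None \<Rightarrow> Leaf
     | Some e \<Rightarrow> THE c. \<exists>v\<in>e. col T v = Some Black \<and> has_code c T v (Some e))"

lemma rooted_code_None [simp]: "rooted_code (T, None) = Leaf"
  by (simp add: rooted_code_def)

lemma rooted_code_Some:
  assumes "wbp_tree T" "e \<in> edges T" "v \<in> e" "col T v = Some Black"
  shows "rooted_code (T, Some e) = c \<longleftrightarrow> has_code c T v (Some e)"
proof -
  have P: "plane_tree T" using assms(1) by (simp add: wbp_tree_iff)
  obtain c0 where c0: "has_code c0 T v (Some e)"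
    using has_code_exists[OF wbp_tree_dart_tree[OF assms(1-3)]] by blast
  have uni: "w = v" if "w \<in> e" "col T w = Some Black" for w
    using plane_tree_black_end[OF P assms(2)] assms(3,4) that by blast
  have "rooted_code (T, Some e) = (THE c. \<exists>v\<in>e. col T v = Some Black \<and> has_code c T v (Some e))"
    by (simp add: rooted_code_def)
  also have "\<dots> = c0"
  proof (rule the_equality)
    show "\<exists>v\<in>e. col T v = Some Black \<and> has_code c0 T v (Some e)" using c0 assms by blast
    fix c assume "\<exists>v\<in>e. col T v = Some Black \<and> has_code c T v (Some e)"
    then have "has_code c T v (Some e)" using uni by blast
    then show "c = c0" using has_code_unique[OF _ c0] by blast
  qed
  finally show ?thesis using c0 has_code_unique[OF c0] by blast
qed

lemma rooted_code_size:
  assumes "rooted_wbp_tree (T, r)"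
  shows "nodes (rooted_code (T, r)) = card (edges T)" "weight (rooted_code (T, r)) = total_weight T"
proof -
  have "nodes (rooted_code (T, r)) = card (edges T) \<and> weight (rooted_code (T, r)) = total_weight T"
  proof (cases r)
    case None
    then show ?thesis using assms by (simp add: rooted_wbp_tree_def total_weight_def)
  next
    case (Some e)
    then have T: "wbp_tree T" and e: "e \<in> edges T" using assms by (auto simp: rooted_wbp_tree_def)
    then obtain v where v: "v \<in> e" "col T v = Some Black"
      using plane_tree_black_end[of T e] by (auto simp: wbp_tree_iff)
    then show ?thesis
      using has_code_size[OF wbp_tree_dart_tree[OF T e v(1)]] rooted_code_Some[OF T e v] Some by metis
  qed
  then show "nodes (rooted_code (T, r)) = card (edges T)"
    "weight (rooted_code (T, r)) = total_weight T" by auto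
qed

lemma rooted_code_Some_not_Leaf:
  assumes "wbp_tree T" "e \<in> edges T"
  shows "rooted_code (T, Some e) \<noteq> Leaf"
proof
  assume "rooted_code (T, Some e) = Leaf"
  then have "card (edges T) = 0"
    using rooted_code_size(1)[of T "Some e"] assms by (simp add: rooted_wbp_tree_def)
  then show False
    using assms plane_tree_finite_edges[of T] by (simp add: wbp_tree_iff)
qed

lemma tree_iso_plane_iso: "tree_iso \<phi> T T' \<Longrightarrow> plane_iso \<phi> T T'"
  by (simp add: tree_iso_iff_plane_iso)

lemma rooted_code_tree_iso:
  assumes T: "wbp_tree T" "e \<in> edges T" and T': "wbp_tree T'" and iso: "tree_iso \<phi> T T'"
  shows "\<phi> ` e \<in> edges T'" "rooted_code (T', Some (\<phi> ` e)) = rooted_code (T, Some e)"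
proof -
  have P: "plane_tree T" "plane_tree T'" using T T' by (simp_all add: wbp_tree_iff)
  obtain v where v: "v \<in> e" "col T v = Some Black" using plane_tree_black_end[OF P(1) T(2)] by blast
  show e': "\<phi> ` e \<in> edges T'" using T(2) plane_iso_edges[OF P tree_iso_plane_iso[OF iso]] by blast
  have "v \<in> verts T" using plane_tree_edge_subset[OF P(1) T(2)] v by blast
  then have v': "\<phi> v \<in> \<phi> ` e" "col T' (\<phi> v) = Some Black"
    using v iso by (auto simp: tree_iso_def)
  have c: "has_code (rooted_code (T, Some e)) T v (Some e)"
    using rooted_code_Some[OF T v] by blast
  show "rooted_code (T', Some (\<phi> ` e)) = rooted_code (T, Some e)"
    using has_code_plane_iso[OF wbp_tree_dart_tree[OF T v(1)] P(2) tree_iso_plane_iso[OF iso] c]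
      rooted_code_Some[OF T' e' v'] by simp
qed

lemma rooted_code_eq_imp_iso:
  assumes T: "wbp_tree T" "e \<in> edges T" and T': "wbp_tree T'" "e' \<in> edges T'"
    and eq: "rooted_code (T, Some e) = rooted_code (T', Some e')"
  shows "\<exists>\<phi>. tree_iso \<phi> T T' \<and> \<phi> ` e = e'"
proof -
  have P: "plane_tree T" "plane_tree T'" using T T' by (simp_all add: wbp_tree_iff)
  obtain v where v: "v \<in> e" "col T v = Some Black" using plane_tree_black_end[OF P(1) T(2)] by blast
  obtain v' where v': "v' \<in> e'" "col T' v' = Some Black"
    using plane_tree_black_end[OF P(2) T'(2)] by blast
  have c: "has_code (rooted_code (T, Some e)) T v (Some e)"
    using rooted_code_Some[OF T v] by blast
  have c': "has_code (rooted_code (T, Some e)) T' v' (Some e')"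
    using rooted_code_Some[OF T' v'] eq by metis
  obtain \<phi> where \<phi>: "plane_iso \<phi> T T'" "\<phi> v = v'" "\<phi> ` e = e'"
    using has_code_imp_plane_iso[OF wbp_tree_dart_tree[OF T v(1)] wbp_tree_dart_tree[OF T' v'(1)] c c']
    by auto
  have "v \<in> verts T" using plane_tree_edge_subset[OF P(1) T(2)] v by blast
  then have "\<forall>x\<in>verts T. col T' (\<phi> x) = col T x"
    using plane_iso_col[OF P \<phi>(1), of v] \<phi>(2) v v' by simp
  then show ?thesis using \<phi> by (auto simp: tree_iso_iff_plane_iso)
qed

lemma edgeless_tree_iso:
  assumes "wbp_tree T" "edges T = {}" "wbp_tree T'" "edges T' = {}"
  shows "\<exists>\<phi>. tree_iso \<phi> T T'"
proof -
  have "\<exists>v. verts S = {v}" if S: "wbp_tree S" "edges S = {}" for S :: "'x wtree"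
  proof -
    have "verts S \<noteq> {}"
      using S by (auto simp: wbp_tree_def finite_tree_def connected_graph_def)
    then obtain v where "v \<in> verts S" by blast
    moreover have "incident S v = {}" using S by (simp add: incident_def)
    ultimately show ?thesis using plane_tree_no_incident(2)[of S v] S by (auto simp: wbp_tree_iff)
  qed
  then obtain v v' where "verts T = {v}" "verts T' = {v'}" using assms by meson
  then show ?thesis
    using assms
    by (intro exI[of _ "\<lambda>_. v'"]) (auto simp: tree_iso_def bij_betw_def incident_def wbp_tree_iff)
qed

text \<open>Isomorphism is exhibited as the kernel of \<open>rooted_code\<close>, so that counting
  classes becomes counting codes. Roots \<open>None\<close> and \<open>Some e\<close> are never
  confused, since only the edgeless tree has code \<open>Leaf\<close>.\<close>

lemma rooted_isomorphic_iff:
  "rooted_isomorphic = {(X, X'). rooted_wbp_tree X \<and> rooted_wbp_tree X' \<and>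
     rooted_code X = rooted_code X'}"
proof -
  have iff: "(\<exists>\<phi>. tree_iso \<phi> T T' \<and> map_option ((`) \<phi>) r = r') \<longleftrightarrow>
      rooted_code (T, r) = rooted_code (T', r')"
    if "rooted_wbp_tree (T, r)" "rooted_wbp_tree (T', r')"
    for T :: "'a wtree" and T' :: "'a wtree" and r r'
  proof (cases r)
    case None
    show ?thesis
    proof (cases r')
      case None
      with \<open>r = None\<close> show ?thesis
        using that edgeless_tree_iso[of T T'] by (simp add: rooted_wbp_tree_def)
    next
      case (Some e')
      with \<open>r = None\<close> show ?thesis
        using that rooted_code_Some_not_Leaf[of T' e'] by (auto simp: rooted_wbp_tree_def)
    qed
  next
    case (Some e)
    then have T: "wbp_tree T" "e \<in> edges T" using that by (auto simp: rooted_wbp_tree_def)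
    show ?thesis
    proof (cases r')
      case None
      with Some show ?thesis using rooted_code_Some_not_Leaf[OF T] by auto
    next
      case (Some e')
      then have T': "wbp_tree T'" "e' \<in> edges T'" using that by (auto simp: rooted_wbp_tree_def)
      have "(\<exists>\<phi>. tree_iso \<phi> T T' \<and> \<phi> ` e = e') \<longleftrightarrow>
          rooted_code (T, Some e) = rooted_code (T', Some e')"
        using rooted_code_tree_iso(2)[OF T T'(1)] rooted_code_eq_imp_iso[OF T T'] by metis
      then show ?thesis using \<open>r = Some e\<close> \<open>r' = Some e'\<close> by simp
    qed
  qed
  show ?thesis
  proof (rule set_eqI)
    fix p :: "('a wtree \<times> 'a set option) \<times> ('a wtree \<times> 'a set option)"
    obtain T r T' r' where p: "p = ((T, r), (T', r'))" by (metis surj_pair)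
    show "p \<in> rooted_isomorphic \<longleftrightarrow> p \<in> {(X, X'). rooted_wbp_tree X \<and> rooted_wbp_tree X' \<and>
        rooted_code X = rooted_code X'}"
      unfolding p rooted_isomorphic_def using iff[of T r T' r'] by auto
  qed
qed

lemma rooted_code_surj:
  "\<exists>(T :: nat wtree) r. rooted_wbp_tree (T, r) \<and> rooted_code (T, r) = c"
proof (cases c)
  case Leaf
  \<comment> \<open>\<open>has_code_realised\<close> would yield a coloured vertex here, while the
    tree without edges must be uncoloured.\<close>
  define T :: "nat wtree" where
    "T = \<lparr>verts = {0}, edges = {}, col = \<lambda>_. None, rot = \<lambda>_ d. d, wt = \<lambda>_. 1\<rparr>"
  have "rooted_wbp_tree (T, None)"
    by (simp add: T_def rooted_wbp_tree_def wbp_tree_def finite_tree_iff connected_graph_def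
        all_bridges_def incident_def)
  moreover have "rooted_code (T, None) = c" using Leaf by simp
  ultimately show ?thesis by blast
next
  case (Node k L R)
  obtain T :: "nat wtree" and v r where T: "dart_tree T v r" "has_code c T v r" "col T v = Some Black"
    using has_code_realised[of "{}" c Black] by auto
  then obtain e where e: "r = Some e" using Node by auto
  then have E: "e \<in> edges T" "v \<in> e" using T by (auto simp: dart_tree_def incident_def)
  then have W: "wbp_tree T" using T by (auto simp: wbp_tree_iff dart_tree_def)
  have "rooted_code (T, r) = c" using rooted_code_Some[OF W E T(3)] T(2) e by simp
  moreover have "rooted_wbp_tree (T, r)" using W E e by (simp add: rooted_wbp_tree_def)
  ultimately show ?thesis by blast
qed

text \<open>A class is a full fibre of g in U, even if X is smaller, and is therefore named by the
  value of g on it.\<close>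

lemma card_quotient_kernel:
  assumes "R = {(x, y). x \<in> U \<and> y \<in> U \<and> g x = g y}" "X \<subseteq> U"
  shows "card (X // R) = card (g ` X)"
proof -
  have "R `` {x} = {y \<in> U. g y = g x}" if "x \<in> X" for x
    using assms that by auto
  then have "X // R = (\<lambda>c. {y \<in> U. g y = c}) ` g ` X"
    unfolding quotient_def image_image by auto
  moreover have "inj_on (\<lambda>c. {y \<in> U. g y = c}) (g ` X)"
    using assms(2) by (auto simp: inj_on_def)
  ultimately show ?thesis by (simp add: card_image)
qed

lemma num_rooted_eq: "num_rooted n = card {c. weight c = n}"
proof -
  let ?X = "{(T :: nat wtree, r). rooted_wbp_tree (T, r) \<and> total_weight T = n}"
  have "rooted_code ` ?X = {c. weight c = n}"
  proof (intro equalityI subsetI)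
    fix c assume "c \<in> {c. weight c = n}"
    then show "c \<in> rooted_code ` ?X"
      using rooted_code_surj[of c] rooted_code_size(2) by fastforce
  qed (auto simp: rooted_code_size)
  then show ?thesis
    unfolding num_rooted_def
    by (subst card_quotient_kernel[where U = "Collect rooted_wbp_tree" and g = rooted_code])
      (auto simp: rooted_isomorphic_iff)
qed

lemma num_rooted_edges_eq: "num_rooted_edges m n = card {c. weight c = n \<and> nodes c = m}"
proof -
  let ?X = "{(T :: nat wtree, r). rooted_wbp_tree (T, r) \<and> total_weight T = n \<and> card (edges T) = m}"
  have "rooted_code ` ?X = {c. weight c = n \<and> nodes c = m}"
  proof (intro equalityI subsetI)
    fix c assume "c \<in> {c. weight c = n \<and> nodes c = m}"
    then show "c \<in> rooted_code ` ?X"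
      using rooted_code_surj[of c] rooted_code_size by fastforce
  qed (auto simp: rooted_code_size)
  then show ?thesis
    unfolding num_rooted_edges_def
    by (subst card_quotient_kernel[where U = "Collect rooted_wbp_tree" and g = rooted_code])
      (auto simp: rooted_isomorphic_iff)
qed

section \<open>The mass of unrooted trees\<close>

text \<open>Agreement at a vertex and one of its edges spreads along the cyclic order, then to the
  neighbours. Hence automorphisms act freely on the edges.\<close>

lemma plane_iso_eqI:
  assumes P: "plane_tree T" and iso: "plane_iso \<phi> T T'" "plane_iso \<psi> T T'"
    and v: "v \<in> verts T" "\<phi> v = \<psi> v" and e: "e \<in> incident T v" "\<phi> ` e = \<psi> ` e"
    and x: "x \<in> verts T"
  shows "\<phi> x = \<psi> x"
proof -
  have spread: "\<phi> ` d = \<psi> ` d"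
    if y: "y \<in> verts T" "\<phi> y = \<psi> y" and d0: "d0 \<in> incident T y" "\<phi> ` d0 = \<psi> ` d0"
      and d: "d \<in> incident T y" for y d0 d
  proof -
    have step: "\<phi> ` rot T y a = \<psi> ` rot T y a" if "a \<in> incident T y" "\<phi> ` a = \<psi> ` a" for a
      using plane_iso_rot[OF iso(1) y(1) that(1)] plane_iso_rot[OF iso(2) y(1) that(1)] that y(2)
      by simp
    have "incident T y \<noteq> {}" using d by blast
    from plane_tree_cyclic[OF P y(1) this] have "d \<in> orbit (rot T y) d0"
      using d0(1) d unfolding cyclic_on_alldef by blast
    then have "d \<in> incident T y \<and> \<phi> ` d = \<psi> ` d"
    proof induction
      case base
      show ?case using step[OF d0] plane_tree_rot_incident[OF P y(1) d0(1)] by blast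
    next
      case (step a)
      then show ?case
        using \<open>\<And>a. _ \<Longrightarrow> _ \<Longrightarrow> \<phi> ` rot T y a = _\<close> plane_tree_rot_incident[OF P y(1)] by blast
    qed
    then show ?thesis by blast
  qed
  have "x \<in> verts T \<and> \<phi> x = \<psi> x \<and> (\<forall>d\<in>incident T x. \<phi> ` d = \<psi> ` d)"
    using plane_tree_connected[OF P v(1) x]
  proof (induction rule: rtrancl_induct)
    case base
    show ?case using v spread[OF v e] by blast
  next
    case (step y z)
    then have yz: "{y, z} \<in> edges T" by simp
    then have "{y, z} \<in> incident T y" by (simp add: incident_def)
    then have eq: "\<phi> ` {y, z} = \<psi> ` {y, z}" using step(3) by blast
    then have "\<phi> z = \<psi> z" using step(3) by (auto simp: doubleton_eq_iff)
    moreover have "z \<in> verts T" using plane_tree_edge_subset[OF P yz] by simp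
    moreover have "{y, z} \<in> incident T z" using yz by (simp add: incident_def)
    ultimately show ?case using spread[of z "{y, z}"] eq by blast
  qed
  then show ?thesis by blast
qed

text \<open>Allows an isomorphism to be reset to the identity outside the tree, as membership in
  \<open>Aut\<close> demands.\<close>

lemma tree_iso_cong:
  assumes "plane_tree T" "tree_iso \<phi> T T'" "\<And>x. x \<in> verts T \<Longrightarrow> \<psi> x = \<phi> x"
  shows "tree_iso \<psi> T T'"
proof -
  have im: "\<psi> ` d = \<phi> ` d" if "d \<in> edges T" for d
    using assms(3) plane_tree_edge_subset[OF assms(1) that] by (intro image_cong) auto
  have im_rot: "\<psi> ` rot T v d = \<phi> ` rot T v d" if "v \<in> verts T" "d \<in> incident T v" for v d
    using im plane_tree_rot_incident[OF assms(1) that] by (simp add: incident_def)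
  have im_inc: "\<psi> ` d = \<phi> ` d" if "d \<in> incident T v" for v d
    using im that by (simp add: incident_def)
  have "bij_betw \<psi> (verts T) (verts T')"
    using assms(2,3) bij_betw_cong[of "verts T" \<psi> \<phi>] by (simp add: tree_iso_def)
  then show ?thesis
    using assms(2,3) im im_rot im_inc by (simp add: tree_iso_def cong: image_cong_simp)
qed

text \<open>The edges that give the same code as e form the orbit of e under \<open>Aut T\<close>,
  and the action is free, so evaluation at e is a bijection from the group onto this fibre.\<close>

lemma card_Aut_fibre:
  assumes T: "wbp_tree T" and e: "e \<in> edges T"
  shows "card {d \<in> edges T. rooted_code (T, Some d) = rooted_code (T, Some e)} = card (Aut T)"
proof -
  have P: "plane_tree T" using T by (simp add: wbp_tree_iff)
  obtain v where v: "v \<in> e" "col T v = Some Black" using plane_tree_black_end[OF P e] by blast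
  then have vT: "v \<in> verts T" using plane_tree_edge_subset[OF P e] by blast
  have "bij_betw (\<lambda>\<phi>. \<phi> ` e) (Aut T)
      {d \<in> edges T. rooted_code (T, Some d) = rooted_code (T, Some e)}"
    unfolding bij_betw_def
  proof (intro conjI)
    show "inj_on (\<lambda>\<phi>. \<phi> ` e) (Aut T)"
    proof (rule inj_onI)
      fix \<phi> \<psi> assume A: "\<phi> \<in> Aut T" "\<psi> \<in> Aut T" and eq: "\<phi> ` e = \<psi> ` e"
      then have iso: "tree_iso \<phi> T T" "tree_iso \<psi> T T" and perm: "\<phi> permutes verts T" "\<psi> permutes verts T"
        by (auto simp: Aut_def)
      have "\<phi> ` e \<in> edges T" using rooted_code_tree_iso(1)[OF T e T iso(1)] .
      \<comment> \<open>Equal images of e as sets could still be reversed; both images of v are the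
        black end of the same edge, which forces them to agree.\<close>
      moreover have "\<phi> v \<in> \<phi> ` e" "\<psi> v \<in> \<phi> ` e" using v eq by auto
      moreover have "col T (\<phi> v) = Some Black" "col T (\<psi> v) = Some Black"
        using iso vT v by (simp_all add: tree_iso_def)
      ultimately have "\<phi> v = \<psi> v" using plane_tree_black_end[OF P] by blast
      moreover have "e \<in> incident T v" using e v by (simp add: incident_def)
      ultimately have "\<phi> x = \<psi> x" if "x \<in> verts T" for x
        using plane_iso_eqI[OF P tree_iso_plane_iso[OF iso(1)] tree_iso_plane_iso[OF iso(2)] vT _ _ eq that]
        by blast
      moreover have "\<phi> x = \<psi> x" if "x \<notin> verts T" for x
        using that perm by (simp add: permutes_def)
      ultimately show "\<phi> = \<psi>" by blast
    qed
    show "(\<lambda>\<phi>. \<phi> ` e) ` Aut T = {d \<in> edges T. rooted_code (T, Some d) = rooted_code (T, Some e)}"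
    proof (intro equalityI subsetI)
      fix d assume "d \<in> (\<lambda>\<phi>. \<phi> ` e) ` Aut T"
      then obtain \<phi> where "tree_iso \<phi> T T" "d = \<phi> ` e" by (auto simp: Aut_def)
      then show "d \<in> {d \<in> edges T. rooted_code (T, Some d) = rooted_code (T, Some e)}"
        using rooted_code_tree_iso[OF T e T] by simp
    next
      fix d assume "d \<in> {d \<in> edges T. rooted_code (T, Some d) = rooted_code (T, Some e)}"
      then obtain \<phi> where \<phi>: "tree_iso \<phi> T T" "\<phi> ` e = d"
        using rooted_code_eq_imp_iso[OF T e T, of d] by auto
      define \<psi> where "\<psi> x = (if x \<in> verts T then \<phi> x else x)" for x
      have iso: "tree_iso \<psi> T T" by (rule tree_iso_cong[OF P \<phi>(1)]) (simp add: \<psi>_def)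
      then have "\<psi> permutes verts T"
        by (intro bij_imp_permutes) (simp_all add: tree_iso_def \<psi>_def)
      with iso have "\<psi> \<in> Aut T" by (simp add: Aut_def)
      moreover have "\<psi> ` e = d"
        using \<phi>(2) plane_tree_edge_subset[OF P e] by (auto simp: \<psi>_def)
      ultimately show "d \<in> (\<lambda>\<phi>. \<phi> ` e) ` Aut T" by blast
    qed
  qed
  then show ?thesis by (simp add: bij_betw_same_card)
qed

text \<open>The codes of all rootings of one tree; for trees with edges this set is a complete
  invariant of the unrooted isomorphism class.\<close>

definition root_codes :: "'v wtree \<Rightarrow> btree set" where
  "root_codes T = (\<lambda>e. rooted_code (T, Some e)) ` edges T"

lemma root_codes_empty_iff [simp]: "root_codes T = {} \<longleftrightarrow> edges T = {}"
  by (simp add: root_codes_def)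

text \<open>Orbit counting: the fibres of the code map partition the edges, and each has as many
  elements as \<open>Aut T\<close>.\<close>

lemma card_edges_eq_Aut:
  assumes "wbp_tree T"
  shows "card (edges T) = card (root_codes T) * card (Aut T)"
proof -
  have fin: "finite (edges T)" using assms plane_tree_finite_edges by (auto simp: wbp_tree_iff)
  have "card (edges T) = (\<Sum>e\<in>edges T. 1)" by simp
  also have "\<dots> = (\<Sum>c\<in>root_codes T. \<Sum>e\<in>{d \<in> edges T. rooted_code (T, Some d) = c}. 1)"
    unfolding root_codes_def by (rule sum.image_gen[OF fin])
  also have "\<dots> = (\<Sum>c\<in>root_codes T. card (Aut T))"
  proof (rule sum.cong)
    fix c assume "c \<in> root_codes T"
    then show "(\<Sum>e\<in>{d \<in> edges T. rooted_code (T, Some d) = c}. 1) = card (Aut T)"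
      using card_Aut_fibre[OF assms] by (auto simp: root_codes_def)
  qed simp
  finally show ?thesis by simp
qed

text \<open>A single common code already yields an isomorphism, and an isomorphism makes all codes
  common. Hence code sets of different classes are disjoint.\<close>

lemma isomorphic_iff_root_codes:
  assumes T: "wbp_tree T" "edges T \<noteq> {}" and T': "wbp_tree T'"
  shows "(T, T') \<in> isomorphic \<longleftrightarrow> root_codes T = root_codes T'"
    and "(T, T') \<in> isomorphic \<longleftrightarrow> root_codes T \<inter> root_codes T' \<noteq> {}"
proof -
  have 1: "root_codes T = root_codes T'" if iso: "(T, T') \<in> isomorphic"
  proof -
    obtain \<phi> where \<phi>: "tree_iso \<phi> T T'" using iso by (auto simp: isomorphic_def)
    then have "edges T' = (`) \<phi> ` edges T" by (simp add: tree_iso_def)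
    then show ?thesis
      using rooted_code_tree_iso(2)[OF T(1) _ T' \<phi>] by (simp add: root_codes_def image_image)
  qed
  have 2: "(T, T') \<in> isomorphic" if ne: "root_codes T \<inter> root_codes T' \<noteq> {}"
  proof -
    obtain e e' where "e \<in> edges T" "e' \<in> edges T'"
      "rooted_code (T, Some e) = rooted_code (T', Some e')"
      using ne by (auto simp: root_codes_def)
    then show ?thesis
      using rooted_code_eq_imp_iso[OF T(1) _ T'] T(1) T' unfolding isomorphic_def by blast
  qed
  show "(T, T') \<in> isomorphic \<longleftrightarrow> root_codes T = root_codes T'"
    "(T, T') \<in> isomorphic \<longleftrightarrow> root_codes T \<inter> root_codes T' \<noteq> {}"
    using 1 2 T(2) by (metis inf.idem root_codes_empty_iff)+
qed

lemma finite_weight_le: "finite {c. weight c \<le> n}"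
proof (induction n)
  case 0
  have "{c. weight c \<le> 0} \<subseteq> {Leaf}"
  proof
    fix c assume "c \<in> {c. weight c \<le> 0}"
    then show "c \<in> {Leaf}" by (cases c) auto
  qed
  then show ?case using finite_subset by blast
next
  case (Suc n)
  let ?S = "{c. weight c \<le> n}"
  have "{c. weight c \<le> Suc n} \<subseteq> insert Leaf ((\<lambda>(k, L, R). Node k L R) ` ({..n} \<times> ?S \<times> ?S))"
  proof
    fix c assume "c \<in> {c. weight c \<le> Suc n}"
    then show "c \<in> insert Leaf ((\<lambda>(k, L, R). Node k L R) ` ({..n} \<times> ?S \<times> ?S))"
      by (cases c) (auto simp: image_iff)
  qed
  then show ?case using Suc finite_subset by (metis finite_SigmaI finite_atMost finite_imageI finite_insert)
qed

lemma finite_weight: "finite {c. weight c = n}"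
  by (rule finite_subset[OF _ finite_weight_le[of n]]) auto

text \<open>A class with code set K and m edges contributes 1 / |Aut| = |K| / m, which is 1 / m for
  each code in K. The sets K partition the codes of weight n, so the contributions add up to a sum
  over codes.\<close>

lemma unrooted_mass_eq:
  assumes "n \<ge> 1"
  shows "unrooted_mass n = (\<Sum>c | weight c = n. 1 / real (nodes c))"
proof -
  let ?U = "{T :: nat wtree. wbp_tree T \<and> total_weight T = n}"
  let ?cls = "\<lambda>K. {T :: nat wtree. wbp_tree T \<and> root_codes T = K}"
  have ne: "edges T \<noteq> {}" if "T \<in> ?U" for T
    using that assms by (auto simp: total_weight_def)
  have cls: "isomorphic `` {T} = ?cls (root_codes T)" if "T \<in> ?U" for T
    using isomorphic_iff_root_codes(1)[of T] ne[OF that] that by (auto simp: isomorphic_def)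
  have Q: "?U // isomorphic = ?cls ` root_codes ` ?U"
    unfolding quotient_def using cls by auto
  have inj: "inj_on ?cls (root_codes ` ?U)"
    by (auto simp: inj_on_def)
  have code: "nodes c = card (edges T) \<and> weight c = n" if "T \<in> ?U" "c \<in> root_codes T" for T c
    using that rooted_code_size[of T] by (auto simp: root_codes_def rooted_wbp_tree_def)
  have U: "\<Union> (root_codes ` ?U) = {c. weight c = n}"
  proof (intro equalityI subsetI)
    fix c assume c: "c \<in> {c. weight c = n}"
    obtain T :: "nat wtree" and r where T: "rooted_wbp_tree (T, r)" "rooted_code (T, r) = c"
      using rooted_code_surj by blast
    then have "total_weight T = n" using rooted_code_size(2)[OF T(1)] c by simp
    moreover obtain e where "r = Some e" using T(2) c assms by (cases r) auto
    ultimately show "c \<in> \<Union> (root_codes ` ?U)"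
      using T by (auto simp: rooted_wbp_tree_def root_codes_def)
  qed (use code in blast)
  have fin: "finite K" if "K \<in> root_codes ` ?U" for K
    using finite_subset[OF Union_upper[OF that]] finite_weight[of n] unfolding U by blast
  have "unrooted_mass n = (\<Sum>K\<in>root_codes ` ?U. 1 / real (the_elem ((\<lambda>T. card (Aut T)) ` ?cls K)))"
    unfolding unrooted_mass_def Q by (subst sum.reindex[OF inj]) simp
  also have "\<dots> = (\<Sum>K\<in>root_codes ` ?U. \<Sum>c\<in>K. 1 / real (nodes c))"
  proof (rule sum.cong)
    fix K assume "K \<in> root_codes ` ?U"
    then obtain T where T: "T \<in> ?U" "K = root_codes T" by blast
    have K: "card K > 0" using fin T ne by (simp add: card_gt_0_iff)
    \<comment> \<open>Makes the argument of \<open>the_elem\<close> a singleton: the order of the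
      group is recovered from the code set and the number of edges, both common to the
      class.\<close>
    have same: "card (Aut T') = card (Aut T)" if T': "T' \<in> ?cls K" for T'
    proof -
      obtain c where "c \<in> K" using K by fastforce
      then obtain e where "e \<in> edges T'" "c = rooted_code (T', Some e)"
        using T' T(2) by (auto simp: root_codes_def)
      then have "card (edges T') = nodes c"
        using rooted_code_size(1)[of T' "Some e"] T' by (simp add: rooted_wbp_tree_def)
      then have "card (edges T') = card (edges T)" using code[OF T(1), of c] \<open>c \<in> K\<close> T(2) by simp
      then have "card K * card (Aut T') = card K * card (Aut T)"
        using card_edges_eq_Aut[of T'] card_edges_eq_Aut[of T] T T' by auto
      then show ?thesis using K by simp
    qed
    have "T \<in> ?cls K" using T by simp
    then have "(\<lambda>T. card (Aut T)) ` ?cls K = {card (Aut T)}" using same by blast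
    then have "1 / real (the_elem ((\<lambda>T. card (Aut T)) ` ?cls K)) = 1 / real (card (Aut T))" by simp
    also have "\<dots> = real (card K) / real (card (edges T))"
      using card_edges_eq_Aut[of T] T K by simp
    also have "\<dots> = (\<Sum>c\<in>K. 1 / real (nodes c))"
      using code[OF T(1)] T(2) by simp
    finally show "1 / real (the_elem ((\<lambda>T. card (Aut T)) ` ?cls K)) = (\<Sum>c\<in>K. 1 / real (nodes c))" .
  qed simp
  also have "\<dots> = (\<Sum>c\<in>\<Union> (root_codes ` ?U). 1 / real (nodes c))"
  proof (rule sum.Union_disjoint[unfolded comp_def, symmetric])
    show "\<forall>K\<in>root_codes ` ?U. finite K" using fin by blast
    show "\<forall>K\<in>root_codes ` ?U. \<forall>K'\<in>root_codes ` ?U. K \<noteq> K' \<longrightarrow> K \<inter> K' = {}"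
      using isomorphic_iff_root_codes ne by blast
  qed
  finally show ?thesis unfolding U .
qed

lemma nodes_le_weight: "nodes c \<le> weight c"
  by (induction c) auto

lemma unrooted_mass_sum:
  assumes "n \<ge> 1"
  shows "unrooted_mass n = (\<Sum>m = 1..n. real (num_rooted_edges m n) / real m)"
proof -
  have sub: "nodes ` {c. weight c = n} \<subseteq> {1..n}"
  proof
    fix m assume "m \<in> nodes ` {c. weight c = n}"
    then obtain c where c: "m = nodes c" "weight c = n" by blast
    then have "nodes c > 0" using assms by (cases c) auto
    then show "m \<in> {1..n}" using c nodes_le_weight[of c] by simp
  qed
  have "unrooted_mass n =
      (\<Sum>m = 1..n. \<Sum>c\<in>{c \<in> {c. weight c = n}. nodes c = m}. 1 / real (nodes c))"
    unfolding unrooted_mass_eq[OF assms]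
    by (rule sum.group[symmetric, OF finite_weight _ sub]) simp
  also have "\<dots> = (\<Sum>m = 1..n. real (num_rooted_edges m n) / real m)"
    by (intro sum.cong) (simp_all add: num_rooted_edges_eq)
  finally show ?thesis .
qed

section \<open>Generating functions\<close>

text \<open>Generic in the semiring so that one recursion serves all counts: s = 1 counts codes,
  \<open>fps_X\<close> records the number of nodes, and \<open>fls_X\<close> gives the Laurent
  coefficients of the double series.\<close>

definition code_sum :: "'a :: comm_semiring_1 \<Rightarrow> nat \<Rightarrow> 'a" where
  "code_sum s n = (\<Sum>c | weight c = n. s ^ nodes c)"

lemma code_sum_0 [simp]: "code_sum s 0 = 1"
proof -
  have "{c. weight c = 0} = {Leaf}"
  proof (intro equalityI subsetI)
    fix c assume "c \<in> {c. weight c = 0}"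
    then show "c \<in> {Leaf}" by (cases c) auto
  qed auto
  then show ?thesis by (simp add: code_sum_def)
qed

text \<open>A code of positive weight either has root label \<open>0\<close>, or its root label can be decreased.\<close>

lemma code_sum_Suc:
  "code_sum s (Suc n) =
     (if n = 0 then 0 else code_sum s n) + s * (\<Sum>j\<le>n. code_sum s j * code_sum s (n - j))"
proof -
  \<comment> \<open>The value at \<open>Leaf\<close> is a default; only nodes are bumped.\<close>
  define bump where "bump c = (case c of Leaf \<Rightarrow> Leaf | Node k L R \<Rightarrow> Node (Suc k) L R)" for c
  let ?W = "\<lambda>n. {c. weight c = n}"
  define A where "A = bump ` {c. weight c = n \<and> c \<noteq> Leaf}"
  define B where "B j = (\<lambda>(L, R). Node 0 L R) ` (?W j \<times> ?W (n - j))" for j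
  have W: "?W (Suc n) = A \<union> (\<Union>j\<le>n. B j)"
  proof (intro equalityI subsetI)
    fix c assume c: "c \<in> ?W (Suc n)"
    then obtain k L R where N: "c = Node k L R" by (cases c) auto
    show "c \<in> A \<union> (\<Union>j\<le>n. B j)"
    proof (cases k)
      case 0
      then have "c \<in> B (weight L)" "weight L \<le> n" using c N by (auto simp: B_def)
      then show ?thesis by blast
    next
      case (Suc k')
      then have "c = bump (Node k' L R)" "Node k' L R \<in> {c. weight c = n \<and> c \<noteq> Leaf}"
        using c N by (auto simp: bump_def)
      then show ?thesis unfolding A_def by blast
    qed
  next
    fix c assume "c \<in> A \<union> (\<Union>j\<le>n. B j)"
    then show "c \<in> ?W (Suc n)"
      by (auto simp: A_def B_def bump_def split: btree.splits)
  qed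
  have fin: "finite A" "\<And>j. finite (B j)"
    using finite_subset[OF _ finite_weight[of n]] finite_weight by (auto simp: A_def B_def)
  have disj: "A \<inter> (\<Union>j\<le>n. B j) = {}"
    by (auto simp: A_def B_def bump_def split: btree.splits)
  have "inj_on bump {c. weight c = n \<and> c \<noteq> Leaf}"
    by (auto simp: inj_on_def bump_def split: btree.splits)
  moreover have "nodes (bump c) = nodes c" for c by (cases c) (simp_all add: bump_def)
  ultimately have "(\<Sum>c\<in>A. s ^ nodes c) = (\<Sum>c | weight c = n \<and> c \<noteq> Leaf. s ^ nodes c)"
    unfolding A_def by (subst sum.reindex) simp_all
  \<comment> \<open>The only code of weight 0 is \<open>Leaf\<close>, which has no root label to
    raise. This is why the term for n disappears from the recursion when n = 0.\<close>
  moreover have "{c. weight c = n \<and> c \<noteq> Leaf} = (if n = 0 then {} else ?W n)"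
  proof -
    have "c = Leaf" if "weight c = 0" for c using that by (cases c) auto
    then show ?thesis by auto
  qed
  ultimately have SA: "(\<Sum>c\<in>A. s ^ nodes c) = (if n = 0 then 0 else code_sum s n)"
    by (auto simp: code_sum_def)
  have SB: "(\<Sum>c\<in>B j. s ^ nodes c) = s * (code_sum s j * code_sum s (n - j))" for j
  proof -
    have "(\<Sum>c\<in>B j. s ^ nodes c) = (\<Sum>(L, R)\<in>?W j \<times> ?W (n - j). s * (s ^ nodes L * s ^ nodes R))"
      unfolding B_def by (subst sum.reindex) (auto simp: inj_on_def power_add intro!: sum.cong)
    also have "\<dots> = s * (\<Sum>(L, R)\<in>?W j \<times> ?W (n - j). s ^ nodes L * s ^ nodes R)"
      by (simp add: sum_distrib_left case_prod_unfold)
    also have "\<dots> = s * (code_sum s j * code_sum s (n - j))"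
      by (simp add: code_sum_def sum_product sum.cartesian_product)
    finally show ?thesis .
  qed
  have "code_sum s (Suc n) = (\<Sum>c\<in>A. s ^ nodes c) + (\<Sum>c\<in>(\<Union>j\<le>n. B j). s ^ nodes c)"
    unfolding code_sum_def W using fin disj by (intro sum.union_disjoint) auto
  also have "(\<Sum>c\<in>(\<Union>j\<le>n. B j). s ^ nodes c) = (\<Sum>j\<le>n. \<Sum>c\<in>B j. s ^ nodes c)"
    using fin by (intro sum.UNION_disjoint) (auto simp: B_def)
  finally show ?thesis by (simp add: SA SB sum_distrib_left)
qed

lemma num_rooted_code_sum: "num_rooted n = code_sum 1 n"
  by (simp add: num_rooted_eq code_sum_def)

lemma num_rooted_code_sum': "of_nat (num_rooted n) = code_sum (1 :: 'a :: comm_semiring_1) n"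
  by (simp add: num_rooted_eq code_sum_def)

lemma num_rooted_edges_code_sum: "num_rooted_edges m n = fps_nth (code_sum fps_X n) m"
proof -
  have "fps_nth (code_sum fps_X n) m = (\<Sum>c | weight c = n. if m = nodes c then 1 else 0)"
    by (simp add: code_sum_def fps_sum_nth fps_X_power_nth)
  also have "\<dots> = card ({c. weight c = n} \<inter> {c. m = nodes c})"
    using finite_weight by (simp add: sum.If_cases)
  also have "{c. weight c = n} \<inter> {c. m = nodes c} = {c. weight c = n \<and> nodes c = m}" by auto
  finally show ?thesis by (simp add: num_rooted_edges_eq)
qed

lemma num_rooted_edges_rec:
  "num_rooted_edges 0 0 = 1" "num_rooted_edges (Suc m) 0 = 0" "num_rooted_edges 0 (Suc n) = 0"
  "num_rooted_edges (Suc m) (Suc n) = num_rooted_edges (Suc m) n +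
     (\<Sum>j\<le>n. \<Sum>i\<le>m. num_rooted_edges i j * num_rooted_edges (m - i) (n - j))"
proof -
  show 1: "num_rooted_edges 0 0 = 1" "num_rooted_edges (Suc m) 0 = 0" for m
    by (simp_all add: num_rooted_edges_code_sum)
  show "num_rooted_edges 0 (Suc n) = 0" for n
    by (induction n) (simp_all add: num_rooted_edges_code_sum code_sum_Suc)
  have "(\<Sum>j\<le>n. code_sum fps_X j * code_sum fps_X (n - j)) $ m =
      (\<Sum>j\<le>n. \<Sum>i\<le>m. num_rooted_edges i j * num_rooted_edges (m - i) (n - j))"
    by (simp add: num_rooted_edges_code_sum fps_sum_nth fps_mult_nth atLeast0AtMost)
  then show "num_rooted_edges (Suc m) (Suc n) = num_rooted_edges (Suc m) n +
     (\<Sum>j\<le>n. \<Sum>i\<le>m. num_rooted_edges i j * num_rooted_edges (m - i) (n - j))"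
    unfolding num_rooted_edges_code_sum[of "Suc m"] code_sum_Suc[of _ n] fps_add_nth fps_X_mult_nth
    by simp
qed

section \<open>The quadratic equation and its solution\<close>

lemma code_sum_gf:
  fixes s :: "'a :: comm_ring_1"
  defines "H \<equiv> Abs_fps (code_sum s)"
  shows "H = 1 + fps_X * (H - 1) + fps_const s * fps_X * H\<^sup>2"
proof (rule fps_ext)
  fix n
  show "H $ n = (1 + fps_X * (H - 1) + fps_const s * fps_X * H\<^sup>2) $ n"
  proof (cases n)
    case 0
    then show ?thesis by (simp add: H_def mult.assoc)
  next
    case (Suc n')
    have "(fps_const s * fps_X * H\<^sup>2) $ Suc n' = s * (\<Sum>j\<le>n'. code_sum s j * code_sum s (n' - j))"
      by (simp add: mult.assoc H_def power2_eq_square fps_mult_nth[of "Abs_fps _"] atLeast0AtMost)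
    then show ?thesis using Suc by (simp add: H_def code_sum_Suc)
  qed
qed

text \<open>The constant coefficient selects the branch of the square root: f + g starts with 2,
  which is nonzero in characteristic 0, so f - g must vanish.\<close>

lemma fps_eq_of_power2_eq:
  fixes f g :: "'a :: field_char_0 fps"
  assumes "f\<^sup>2 = g\<^sup>2" "f $ 0 = 1" "g $ 0 = 1"
  shows "f = g"
proof -
  have "(f - g) * (f + g) = 0" using assms(1) by (simp add: algebra_simps power2_eq_square)
  moreover have "(f + g) $ 0 \<noteq> 0" using assms by simp
  then have "f + g \<noteq> 0" by force
  ultimately show ?thesis by simp
qed

lemma code_sum_discriminant:
  fixes s :: "'a :: comm_ring_1"
  defines "H \<equiv> Abs_fps (code_sum s)"
  shows "(1 - fps_X - 2 * fps_const s * fps_X * H)\<^sup>2 =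
     1 - (2 + 4 * fps_const s) * fps_X + (1 + 4 * fps_const s) * fps_X ^ 2"
proof -
  let ?X = "fps_X :: 'a fps" and ?s = "fps_const s"
  have "H = 1 + ?X * (H - 1) + ?s * ?X * H\<^sup>2" unfolding H_def by (rule code_sum_gf)
  then have e: "H * (1 - ?X) - ?s * ?X * H\<^sup>2 = 1 - ?X" by (simp add: algebra_simps)
  have "(1 - ?X - 2 * ?s * ?X * H)\<^sup>2 = (1 - ?X)\<^sup>2 - 4 * ?s * ?X * (H * (1 - ?X) - ?s * ?X * H\<^sup>2)"
    by (simp add: algebra_simps power2_eq_square)
  also have "\<dots> = 1 - (2 + 4 * ?s) * ?X + (1 + 4 * ?s) * ?X ^ 2"
    unfolding e by (simp add: algebra_simps power2_eq_square)
  finally show ?thesis .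
qed

text \<open>The numerator is literally 2 s t times the series, and this factor is nonzero, so the
  truncating division of power series cancels it exactly.\<close>

lemma code_sum_closed_form:
  fixes s :: "'a :: field_char_0"
  assumes "s \<noteq> 0"
  shows "Abs_fps (code_sum s) =
    (1 - fps_X - fps_sqrt (1 - (2 + 4 * fps_const s) * fps_X + (1 + 4 * fps_const s) * fps_X ^ 2))
      / (2 * fps_const s * fps_X)"
proof -
  let ?H = "Abs_fps (code_sum s)"
  let ?g = "1 - (2 + 4 * fps_const s) * fps_X + (1 + 4 * fps_const s) * fps_X ^ 2"
  have "fps_sqrt ?g = 1 - fps_X - 2 * fps_const s * fps_X * ?H"
  proof (rule fps_eq_of_power2_eq)
    have "?g $ 0 = 1" by (simp add: mult.assoc numeral_fps_const power2_eq_square)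
    then show "(fps_sqrt ?g)\<^sup>2 = (1 - fps_X - 2 * fps_const s * fps_X * ?H)\<^sup>2"
      by (simp only: fps_sqrt_power2 code_sum_discriminant)
  qed (simp_all add: mult.assoc numeral_fps_const)
  then have "1 - fps_X - fps_sqrt ?g = (2 * fps_const s * fps_X) * ?H" by simp
  moreover have "2 * fps_const s * fps_X \<noteq> 0"
    using assms by (simp add: numeral_fps_const)
  ultimately show ?thesis by simp
qed

lemma rooted_gf_code_sum: "rooted_gf = Abs_fps (code_sum 1)"
  unfolding rooted_gf_def by (simp add: num_rooted_code_sum')

lemma fps_to_fls_sum: "fps_to_fls (sum f A) = (\<Sum>x\<in>A. fps_to_fls (f x))"
  by (induction A rule: infinite_finite_induct) simp_all

lemma rooted_edges_gf_code_sum: "rooted_edges_gf = Abs_fps (code_sum fls_X)"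
proof -
  have "fps_to_fls (Abs_fps (\<lambda>m. real (num_rooted_edges m n))) = code_sum fls_X n" for n
  proof -
    have "Abs_fps (\<lambda>m. real (num_rooted_edges m n)) = code_sum fps_X n"
    proof (rule fps_ext)
      fix m
      have "fps_nth (code_sum fps_X n) m = (\<Sum>c | weight c = n. if m = nodes c then 1 else (0 :: real))"
        by (simp add: code_sum_def fps_sum_nth fps_X_power_nth)
      also have "\<dots> = real (\<Sum>c | weight c = n. if m = nodes c then 1 else 0)"
        unfolding of_nat_sum by (intro sum.cong) auto
      also have "(\<Sum>c | weight c = n. if m = nodes c then 1 else 0) = num_rooted_edges m n"
        by (simp add: num_rooted_edges_code_sum code_sum_def fps_sum_nth fps_X_power_nth)
      finally show "Abs_fps (\<lambda>m. real (num_rooted_edges m n)) $ m = code_sum fps_X n $ m" by simp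
    qed
    then show ?thesis by (simp add: code_sum_def fps_to_fls_sum fps_to_fls_power)
  qed
  then show ?thesis unfolding rooted_edges_gf_def by simp
qed

section \<open>Coefficients for a fixed number of edges\<close>

text \<open>\<open>compositions_gf m\<close> is \<open>(t / (1 - t)) ^ m\<close>, which counts compositions into \<open>m\<close> parts.\<close>

definition compositions_gf :: "nat \<Rightarrow> real fps" where
  "compositions_gf m = Abs_fps (\<lambda>n. if m = 0 then (if n = 0 then 1 else 0)
     else if n = 0 then 0 else real ((n - 1) choose (m - 1)))"

text \<open>Each factor 1 - t is an application of Pascal's rule. The identity is kept multiplied
  out, which avoids inverses.\<close>

lemma compositions_gf_power: "(1 - fps_X) ^ m * compositions_gf m = fps_X ^ m"
proof (induction m)
  case 0
  show ?case by (rule fps_ext) (simp add: compositions_gf_def)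
next
  case (Suc m)
  have "(1 - fps_X) * compositions_gf (Suc m) = fps_X * compositions_gf m"
  proof (rule fps_ext)
    fix n
    show "((1 - fps_X) * compositions_gf (Suc m)) $ n = (fps_X * compositions_gf m) $ n"
    proof (cases n)
      case 0
      then show ?thesis by (simp add: compositions_gf_def)
    next
      case (Suc n')
      then show ?thesis
        by (cases m; cases n') (simp_all add: compositions_gf_def left_diff_distrib)
    qed
  qed
  then have "(1 - fps_X) ^ Suc m * compositions_gf (Suc m) =
      fps_X * ((1 - fps_X) ^ m * compositions_gf m)"
    by (simp add: mult_ac)
  then show ?case using Suc by simp
qed

text \<open>Multiplying the recursion for m by a power of 1 - t distributes the powers of t and of 1
  - t over the two factors of each product, since i + (k - i) = k. What remains is the Catalan
  recursion; the power of 1 - t is cancelled at the end.\<close>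

lemma num_rooted_edges_gf:
  "Abs_fps (\<lambda>n. real (num_rooted_edges m n)) = of_nat (catalan m) * compositions_gf m"
proof -
  define B where "B m = Abs_fps (\<lambda>n. real (num_rooted_edges m n))" for m
  have B0: "B 0 = 1"
  proof (rule fps_ext)
    fix n show "B 0 $ n = 1 $ n" by (cases n) (simp_all add: B_def num_rooted_edges_rec)
  qed
  have BS: "(1 - fps_X) * B (Suc m) = fps_X * (\<Sum>i\<le>m. B i * B (m - i))" for m
  proof (rule fps_ext)
    fix n
    show "((1 - fps_X) * B (Suc m)) $ n = (fps_X * (\<Sum>i\<le>m. B i * B (m - i))) $ n"
    proof (cases n)
      case 0
      then show ?thesis by (simp add: B_def num_rooted_edges_rec)
    next
      case (Suc n')
      have "(\<Sum>i\<le>m. B i * B (m - i)) $ n' =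
          (\<Sum>i\<le>m. \<Sum>j\<le>n'. real (num_rooted_edges i j) * real (num_rooted_edges (m - i) (n' - j)))"
        by (simp add: B_def fps_sum_nth fps_mult_nth atLeast0AtMost)
      also have "\<dots> = (\<Sum>j\<le>n'. \<Sum>i\<le>m. real (num_rooted_edges i j) * real (num_rooted_edges (m - i) (n' - j)))"
        by (rule sum.swap)
      finally show ?thesis
        using Suc by (simp add: left_diff_distrib B_def num_rooted_edges_rec(4))
    qed
  qed
  have key: "(1 - fps_X) ^ m * B m = of_nat (catalan m) * fps_X ^ m" for m
  proof (induction m rule: less_induct)
    case (less m)
    show ?case
    proof (cases m)
      case 0
      then show ?thesis by (simp add: B0)
    next
      case (Suc k)
      have "(1 - fps_X) ^ m * B m = (1 - fps_X) ^ k * ((1 - fps_X) * B (Suc k))"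
        unfolding Suc by (simp add: mult_ac)
      also have "\<dots> = fps_X * (\<Sum>i\<le>k. (1 - fps_X) ^ k * (B i * B (k - i)))"
        unfolding BS by (simp add: sum_distrib_left mult_ac)
      also have "(\<Sum>i\<le>k. (1 - fps_X) ^ k * (B i * B (k - i))) =
          (\<Sum>i\<le>k. of_nat (catalan i * catalan (k - i)) * fps_X ^ k)"
      proof (rule sum.cong)
        fix i assume "i \<in> {..k}"
        then have i: "i \<le> k" by simp
        have "(1 - fps_X) ^ k * (B i * B (k - i)) =
            ((1 - fps_X) ^ i * B i) * ((1 - fps_X) ^ (k - i) * B (k - i))"
          using i by (simp add: mult_ac flip: power_add)
        also have "\<dots> = of_nat (catalan i) * fps_X ^ i * (of_nat (catalan (k - i)) * fps_X ^ (k - i))"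
          using less[of i] less[of "k - i"] i Suc by simp
        also have "\<dots> = of_nat (catalan i * catalan (k - i)) * fps_X ^ k"
          using i by (simp add: mult_ac flip: power_add)
        finally show "(1 - fps_X) ^ k * (B i * B (k - i)) =
            of_nat (catalan i * catalan (k - i)) * fps_X ^ k" .
      qed simp
      also have "fps_X * \<dots> = of_nat (catalan m) * fps_X ^ m"
        unfolding Suc by (simp add: sum_distrib_left sum_distrib_right mult_ac)
      finally show ?thesis .
    qed
  qed
  have "(1 - fps_X :: real fps) $ 0 \<noteq> 0" by simp
  then have "(1 - fps_X :: real fps) \<noteq> 0" by force
  then have ne: "(1 - fps_X :: real fps) ^ m \<noteq> 0" by simp
  have "(1 - fps_X) ^ m * B m = (1 - fps_X) ^ m * (of_nat (catalan m) * compositions_gf m)"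
    unfolding key using compositions_gf_power[of m] by (simp add: mult_ac)
  then have "B m = of_nat (catalan m) * compositions_gf m" using ne by simp
  then show ?thesis by (simp add: B_def)
qed

lemma num_rooted_edges_closed_form:
  assumes "m \<ge> 1" "n \<ge> 1"
  shows "num_rooted_edges m n = ((n - 1) choose (m - 1)) * catalan m"
proof -
  have "real (num_rooted_edges m n) = Abs_fps (\<lambda>n. real (num_rooted_edges m n)) $ n" by simp
  also have "\<dots> = (fps_const (real (catalan m)) * compositions_gf m) $ n"
    unfolding num_rooted_edges_gf by (simp add: fps_of_nat)
  also have "\<dots> = real (((n - 1) choose (m - 1)) * catalan m)"
    using assms by (simp add: compositions_gf_def)
  finally show ?thesis using of_nat_eq_iff by blast
qed

section \<open>Square roots of linear polynomials\<close>

text \<open>\<open>sqrt_coeff n\<close> is the coefficient of \<open>t ^ n\<close> in the square root of \<open>1 - t\<close>.\<close>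

definition sqrt_coeff :: "nat \<Rightarrow> real" where
  "sqrt_coeff n = (1 / 2 gchoose n) * (-1) ^ n"

definition sqrt_series :: "real \<Rightarrow> real fps" where
  "sqrt_series a = Abs_fps (\<lambda>n. sqrt_coeff n * a ^ n)"

lemma sqrt_coeff_0 [simp]: "sqrt_coeff 0 = 1"
  by (simp add: sqrt_coeff_def)

lemma sqrt_coeff_Suc: "sqrt_coeff (Suc n) = sqrt_coeff n * (real n - 1 / 2) / (real n + 1)"
proof -
  have e: "(1 / 2 :: real) gchoose Suc n = (1 / 2 gchoose n) * (1 / 2 - real n) / (real n + 1)"
    using gbinomial_mult_1[of "1 / 2 :: real" n]
    by (simp add: field_simps)
  show ?thesis unfolding sqrt_coeff_def power_Suc e by (simp add: divide_simps algebra_simps)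
qed

text \<open>Vandermonde's identity with 1/2 + 1/2 = 1: the square is the binomial series of exponent
  1, which stops after the linear term.\<close>

lemma sqrt_series_power2: "(sqrt_series a)\<^sup>2 = 1 - fps_const a * fps_X"
proof (rule fps_ext)
  fix n
  have "(sqrt_series a)\<^sup>2 $ n =
      (\<Sum>k=0..n. ((1 / 2 gchoose k) * (1 / 2 gchoose (n - k))) * ((-a) ^ k * (-a) ^ (n - k)))"
    by (simp add: power2_eq_square fps_mult_nth sqrt_series_def sqrt_coeff_def
        power_minus[of a] mult_ac)
  also have "\<dots> = (\<Sum>k=0..n. ((1 / 2 gchoose k) * (1 / 2 gchoose (n - k))) * (-a) ^ n)"
    by (intro sum.cong) (simp_all flip: power_add)
  also have "\<dots> = (1 gchoose n) * (-a) ^ n"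
    using gbinomial_Vandermonde[of "1 / 2 :: real" "1 / 2" n] by (simp flip: sum_distrib_right)
  also have "(1 gchoose n) = (real (1 choose n))" by (simp add: binomial_gbinomial)
  also have "real (1 choose n) * (-a) ^ n = (1 - fps_const a * fps_X) $ n"
  proof -
    consider "n = 0" | "n = 1" | k where "n = Suc (Suc k)" by (metis One_nat_def not0_implies_Suc)
    then show ?thesis by cases simp_all
  qed
  finally show "(sqrt_series a)\<^sup>2 $ n = (1 - fps_const a * fps_X) $ n" .
qed

text \<open>The Catalan series C satisfies (1 - 2 t C)^2 = 1 - 4 t. The index moves by one because
  of the factor t in front of C.\<close>

lemma catalan_sqrt_coeff: "real (catalan m) = - (1 / 2) * sqrt_coeff (Suc m) * 4 ^ Suc m"
proof -
  define C where "C = Abs_fps (\<lambda>n. real (catalan n))"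
  have "C = 1 + fps_X * C\<^sup>2"
  proof (rule fps_ext)
    fix n show "C $ n = (1 + fps_X * C\<^sup>2) $ n"
      by (cases n) (simp_all add: C_def power2_eq_square fps_mult_nth[of "Abs_fps _"] atLeast0AtMost)
  qed
  then have e: "C - fps_X * C\<^sup>2 = 1" by (simp add: algebra_simps)
  have "(1 - 2 * fps_X * C)\<^sup>2 = 1 - 4 * fps_X * (C - fps_X * C\<^sup>2)"
    by (simp add: algebra_simps power2_eq_square)
  also have "\<dots> = (sqrt_series 4)\<^sup>2"
    unfolding e sqrt_series_power2 by (simp add: numeral_fps_const)
  finally have "1 - 2 * fps_X * C = sqrt_series 4"
    by (rule fps_eq_of_power2_eq) (simp_all add: sqrt_series_def mult.assoc numeral_fps_const)
  then have "(1 - 2 * fps_X * C) $ Suc m = sqrt_series 4 $ Suc m" by simp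
  then show ?thesis by (simp add: sqrt_series_def C_def mult.assoc numeral_fps_const)
qed

text \<open>Both sides have the same quotient of consecutive terms, 2 (2 m + 1) / (m + 2); for the
  Catalan numbers it comes from the recursion of \<open>sqrt_coeff\<close>.\<close>

lemma catalan_closed_form: "real (catalan m) = 1 / real (m + 1) * real ((2 * m) choose m)"
proof (induction m)
  case (Suc m)
  have 1: "real (catalan (Suc m)) = real (catalan m) * 4 * (real m + 1 / 2) / (real m + 2)"
    unfolding catalan_sqrt_coeff sqrt_coeff_Suc[of "Suc m"] by (simp add: field_simps)
  have 2: "real (2 * Suc m choose Suc m) = real (2 * m choose m) * 2 * (2 * real m + 1) / (real m + 1)"
  proof -
    have 1: "Suc m * (2 * Suc m choose Suc m) = 2 * Suc m * (Suc (2 * m) choose m)"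
      using Suc_times_binomial[of m "Suc (2 * m)"] by simp
    have 2: "Suc m * (Suc (2 * m) choose m) = Suc (2 * m) * (2 * m choose m)"
      using binomial_absorb_comp[of "Suc (2 * m)" m] by simp
    have "real (Suc m) * real (2 * Suc m choose Suc m) = 2 * real (Suc m) * real (Suc (2 * m) choose m)"
      using 1 by (metis (mono_tags, lifting) of_nat_mult of_nat_numeral)
    moreover have "real (Suc m) * real (Suc (2 * m) choose m) = real (Suc (2 * m)) * real (2 * m choose m)"
      using 2 by (metis of_nat_mult)
    ultimately show ?thesis by (simp add: field_simps)
  qed
  show ?case unfolding 1 2 Suc by (simp add: divide_simps) (simp add: algebra_simps)
qed simp

section \<open>Asymptotics\<close>

text \<open>At s = 1 the discriminant is 1 - 6 t + 5 t^2 = (1 - t) (1 - 5 t). The coefficient of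
  t^(n+1) is compared, and for n \<ge> 1 the polynomial 1 - t does not contribute to it.\<close>

lemma num_rooted_sqrt_coeff:
  assumes "n \<ge> 1"
  shows "real (num_rooted n) =
    - (1 / 2) * (\<Sum>k\<le>Suc n. sqrt_coeff k * (sqrt_coeff (Suc n - k) * 5 ^ (Suc n - k)))"
proof -
  let ?H = "Abs_fps (code_sum 1) :: real fps"
  have "(1 - fps_X - 2 * fps_const 1 * fps_X * ?H)\<^sup>2 = (sqrt_series 1 * sqrt_series 5)\<^sup>2"
    unfolding code_sum_discriminant power_mult_distrib sqrt_series_power2
    by (simp add: numeral_fps_const[of "num.Bit1 (num.Bit0 num.One)", symmetric] algebra_simps power2_eq_square)
  then have "1 - fps_X - 2 * fps_const 1 * fps_X * ?H = sqrt_series 1 * sqrt_series 5"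
    by (rule fps_eq_of_power2_eq) (simp_all add: sqrt_series_def mult.assoc numeral_fps_const)
  then have "(1 - fps_X - 2 * fps_const 1 * fps_X * ?H) $ Suc n = (sqrt_series 1 * sqrt_series 5) $ Suc n"
    by simp
  moreover have "(1 - fps_X - 2 * fps_const 1 * fps_X * ?H) $ Suc n = -2 * real (num_rooted n)"
    using assms by (simp add: mult.assoc numeral_fps_const num_rooted_code_sum')
  moreover have "(sqrt_series 1 * sqrt_series 5) $ Suc n =
      (\<Sum>k\<le>Suc n. sqrt_coeff k * (sqrt_coeff (Suc n - k) * 5 ^ (Suc n - k)))"
    by (simp only: fps_mult_nth sqrt_series_def fps_nth_Abs_fps atLeast0AtMost power_one mult_1_right)
  ultimately show ?thesis by simp
qed

lemma sqrt_coeff_nonzero: "sqrt_coeff n \<noteq> 0"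
proof (induction n)
  case (Suc n)
  have "real n \<noteq> 1 / 2"
  proof
    assume "real n = 1 / 2"
    then have "real (2 * n) = real 1" by simp
    then have "2 * n = 1" using of_nat_eq_iff by blast
    then show False by presburger
  qed
  then show ?case using Suc by (simp add: sqrt_coeff_Suc)
qed simp

text \<open>The quotient |n - 1/2| / (n + 1) is smallest at n = 1, where it equals 1/4; this is the
  origin of the constant 4. That it stays below 5 makes the majorant in
  \<open>sqrt_coeff_convolution\<close> summable.\<close>

lemma sqrt_coeff_bounds:
  shows sqrt_coeff_le_1: "\<bar>sqrt_coeff n\<bar> \<le> 1"
    and sqrt_coeff_le_Suc: "\<bar>sqrt_coeff n\<bar> \<le> 4 * \<bar>sqrt_coeff (Suc n)\<bar>"
proof -
  have S: "\<bar>sqrt_coeff (Suc n)\<bar> = \<bar>sqrt_coeff n\<bar> * (\<bar>real n - 1 / 2\<bar> / (real n + 1))" for n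
    by (simp add: sqrt_coeff_Suc abs_mult)
  have r: "\<bar>real n - 1 / 2\<bar> / (real n + 1) \<le> 1" "1 \<le> 4 * (\<bar>real n - 1 / 2\<bar> / (real n + 1))" for n
  proof -
    show "\<bar>real n - 1 / 2\<bar> / (real n + 1) \<le> 1" by (simp add: field_simps)
    show "1 \<le> 4 * (\<bar>real n - 1 / 2\<bar> / (real n + 1))"
      by (cases n) (simp_all add: field_simps)
  qed
  show "\<bar>sqrt_coeff n\<bar> \<le> 1"
  proof (induction n)
    case (Suc n)
    then show ?case unfolding S using r(1)[of n] by (intro mult_le_one) auto
  qed simp
  show "\<bar>sqrt_coeff n\<bar> \<le> 4 * \<bar>sqrt_coeff (Suc n)\<bar>"
    using mult_left_mono[OF r(2)[of n], of "\<bar>sqrt_coeff n\<bar>"]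
    unfolding S mult.left_commute[of 4] by simp
qed

lemma sqrt_coeff_shift_bound: "\<bar>sqrt_coeff n\<bar> \<le> 4 ^ k * \<bar>sqrt_coeff (n + k)\<bar>"
proof (induction k)
  case (Suc k)
  show ?case
    using order_trans[OF Suc mult_left_mono[OF sqrt_coeff_le_Suc[of "n + k"], of "4 ^ k"]]
    by (simp add: mult_ac)
qed simp

text \<open>The quotient telescopes into k one-step quotients, each tending to 1. The truncated
  subtraction is correct for large n, and only those matter.\<close>

lemma sqrt_coeff_ratio: "(\<lambda>n. sqrt_coeff (n - k) / sqrt_coeff n) \<longlonglongrightarrow> 1"
proof (induction k)
  case 0
  show ?case by (simp add: sqrt_coeff_nonzero)
next
  case (Suc k)
  have "(\<lambda>n. sqrt_coeff n / sqrt_coeff (Suc n)) = (\<lambda>n. (real n + 1) / (real n - 1 / 2))"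
    using sqrt_coeff_nonzero by (simp add: sqrt_coeff_Suc)
  moreover have "(\<lambda>n. (real n + 1) / (real n - 1 / 2)) \<longlonglongrightarrow> 1" by real_asymp
  ultimately have "(\<lambda>n. sqrt_coeff n / sqrt_coeff (Suc n)) \<longlonglongrightarrow> 1" by simp
  moreover have "filterlim (\<lambda>n. n - Suc k) sequentially sequentially"
    by (rule filterlim_minus_const_nat_at_top)
  ultimately have "(\<lambda>n. sqrt_coeff (n - Suc k) / sqrt_coeff (Suc (n - Suc k))) \<longlonglongrightarrow> 1"
    by (rule filterlim_compose)
  from tendsto_mult[OF this Suc]
  have "(\<lambda>n. sqrt_coeff (n - Suc k) / sqrt_coeff (Suc (n - Suc k)) * (sqrt_coeff (n - k) / sqrt_coeff n))
    \<longlonglongrightarrow> 1" by simp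
  moreover have "\<forall>\<^sub>F n in sequentially.
      sqrt_coeff (n - Suc k) / sqrt_coeff (Suc (n - Suc k)) * (sqrt_coeff (n - k) / sqrt_coeff n) =
      sqrt_coeff (n - Suc k) / sqrt_coeff n"
    using eventually_ge_at_top[of "Suc k"]
  proof eventually_elim
    case (elim n)
    then have "Suc (n - Suc k) = n - k" by simp
    then show ?case using sqrt_coeff_nonzero by simp
  qed
  ultimately show ?case by (rule Lim_transform_eventually)
qed

text \<open>The singularity at \<open>1 / 5\<close> dominates: by Tannery's theorem the factor with coefficients
  \<open>sqrt_coeff k\<close> contributes its value at \<open>1 / 5\<close>.\<close>

lemma sqrt_coeff_convolution:
  "(\<lambda>N. (\<Sum>k\<le>N. sqrt_coeff k * (sqrt_coeff (N - k) * 5 ^ (N - k))) / (5 ^ N * sqrt_coeff N))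
     \<longlonglongrightarrow> sqrt (4 / 5)"
proof -
  \<comment> \<open>The k-th summand divided by the normalising term and extended by 0 beyond N, so
    that the finite sums become series over a fixed index set.\<close>
  define u where "u k N = (if k \<le> N then sqrt_coeff k * (1 / 5) ^ k * (sqrt_coeff (N - k) / sqrt_coeff N) else 0)"
    for k N
  define b where "b k = sqrt_coeff k * (1 / 5) ^ k" for k
  have lim: "(\<lambda>N. u k N) \<longlonglongrightarrow> b k" for k
  proof -
    have "(\<lambda>N. b k * (sqrt_coeff (N - k) / sqrt_coeff N)) \<longlonglongrightarrow> b k * 1"
      by (intro tendsto_intros sqrt_coeff_ratio)
    moreover have "\<forall>\<^sub>F N in sequentially. b k * (sqrt_coeff (N - k) / sqrt_coeff N) = u k N"
      using eventually_ge_at_top[of k] by eventually_elim (simp add: u_def b_def)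
    ultimately show ?thesis by (simp add: Lim_transform_eventually)
  qed
  \<comment> \<open>The factor (1/5)^k beats the growth of the quotient, which is at most 4^k by
    \<open>sqrt_coeff_shift_bound\<close>.\<close>
  have bound: "norm (u k N) \<le> (4 / 5) ^ k" for k N
  proof (cases "k \<le> N")
    case True
    have "\<bar>sqrt_coeff (N - k)\<bar> / \<bar>sqrt_coeff N\<bar> \<le> 4 ^ k"
      using sqrt_coeff_shift_bound[of "N - k" k] True sqrt_coeff_nonzero[of N]
      by (simp add: divide_le_eq)
    then have "\<bar>sqrt_coeff k\<bar> * (1 / 5) ^ k * (\<bar>sqrt_coeff (N - k)\<bar> / \<bar>sqrt_coeff N\<bar>) \<le> 1 * (1 / 5) ^ k * 4 ^ k"
      using sqrt_coeff_le_1[of k] by (intro mult_mono) auto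
    then show ?thesis using True by (simp add: u_def abs_mult power_divide)
  qed (simp add: u_def)
  have "(\<lambda>N. \<Sum>k. u k N) \<longlonglongrightarrow> suminf b"
    using tannerys_theorem[of u b sequentially "\<lambda>k. (4 / 5) ^ k"] lim bound
    by (simp add: summable_geometric always_eventually)
  moreover have "suminf b = sqrt (4 / 5)"
  proof -
    have "(\<lambda>n. (1 / 2 gchoose n) * (- (1 / 5)) ^ n) sums (1 + - (1 / 5 :: real)) powr (1 / 2)"
      by (rule gen_binomial_real) simp
    moreover have "(\<lambda>n. (1 / 2 gchoose n) * (- (1 / 5)) ^ n) = b"
      by (rule ext) (simp add: b_def sqrt_coeff_def power_minus[of "1 / 5"])
    ultimately show ?thesis by (simp add: powr_half_sqrt sums_unique[symmetric])
  qed
  moreover have "(\<Sum>k. u k N) =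
      (\<Sum>k\<le>N. sqrt_coeff k * (sqrt_coeff (N - k) * 5 ^ (N - k))) / (5 ^ N * sqrt_coeff N)" for N
  proof -
    have "(\<Sum>k. u k N) = (\<Sum>k\<le>N. u k N)" by (rule suminf_finite) (auto simp: u_def)
    also have "\<dots> = (\<Sum>k\<le>N. sqrt_coeff k * (sqrt_coeff (N - k) * 5 ^ (N - k)) / (5 ^ N * sqrt_coeff N))"
      by (intro sum.cong) (simp_all add: u_def power_diff power_divide)
    finally show ?thesis by (simp add: sum_divide_distrib)
  qed
  ultimately show ?thesis by simp
qed

text \<open>The asymptotics of generalised binomial coefficients with upper index 1/2 involve 1 /
  Gamma(-1/2), and Gamma(-1/2) = -2 sqrt(pi) follows from Gamma(1/2) = sqrt(pi).\<close>

lemma sqrt_coeff_asymptotic: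
  "(\<lambda>n. sqrt_coeff n * real n powr (3 / 2)) \<longlonglongrightarrow> - 1 / (2 * sqrt pi)"
proof -
  have "Gamma (1 / 2 :: real) = - (1 / 2) * Gamma (- (1 / 2))"
    using Gamma_plus1[of "- (1 / 2) :: real"] fraction_not_in_Ints[of 2 "-1", where 'a = real]
      nonpos_Ints_subset_Ints by fastforce
  then have G: "inverse (Gamma (- (1 / 2) :: real)) = - 1 / (2 * sqrt pi)"
    using Gamma_one_half_real by (simp add: field_simps)
  have "(\<lambda>n. (1 / 2 gchoose n) / ((- 1) ^ n / exp ((1 / 2 + 1) * ln (real n)))) \<longlonglongrightarrow>
      inverse (Gamma (- (1 / 2) :: real))"
    using gbinomial_asymptotic[of "1 / 2 :: real"] by simp
  moreover have "\<forall>\<^sub>F n in sequentially.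
      (1 / 2 gchoose n) / ((- 1) ^ n / exp ((1 / 2 + 1) * ln (real n))) =
      sqrt_coeff n * real n powr (3 / 2)"
    using eventually_gt_at_top[of 0]
  proof eventually_elim
    case (elim n)
    have "(-1 :: real) ^ n * (-1) ^ n = 1" by (simp flip: power_mult_distrib)
    then show ?case using elim by (simp add: sqrt_coeff_def powr_def field_simps)
  qed
  ultimately show ?thesis unfolding G by (rule Lim_transform_eventually)
qed

text \<open>The constant is (-1/2) * 5 * sqrt(4/5) * (-1 / (2 sqrt(pi))) = (1/2) sqrt(5/pi). The
  factor 5 arises because a_n belongs to the coefficient of t^(n+1).\<close>

lemma num_rooted_asymptotic:
  "(\<lambda>n. real (num_rooted n)) \<sim>[sequentially]
     (\<lambda>n. 1 / 2 * sqrt (5 / pi) * 5 ^ n * real n powr (- (3 / 2)))"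
proof (rule asymp_equivI')
  define q where "q N = (\<Sum>k\<le>N. sqrt_coeff k * (sqrt_coeff (N - k) * 5 ^ (N - k))) / (5 ^ N * sqrt_coeff N)" for N
  define r where "r n = sqrt_coeff n * real n powr (3 / 2)" for n
  let ?c = "1 / 2 * sqrt (5 / pi)"
  have "(\<lambda>n. q (Suc n)) \<longlonglongrightarrow> sqrt (4 / 5)" "(\<lambda>n. r (Suc n)) \<longlonglongrightarrow> - 1 / (2 * sqrt pi)"
    using sqrt_coeff_convolution sqrt_coeff_asymptotic
    unfolding q_def[symmetric] r_def[symmetric] by (simp_all add: LIMSEQ_Suc)
  \<comment> \<open>Compensates for the shift of index: \<open>r (Suc n)\<close> carries a power of
    n + 1, whereas the claim has a power of n.\<close>
  moreover have "(\<lambda>n. (real n / real (Suc n)) powr (3 / 2)) \<longlonglongrightarrow> 1"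
    by real_asymp
  ultimately have "(\<lambda>n. - (5 / 2) / ?c * (q (Suc n) * r (Suc n) * (real n / real (Suc n)) powr (3 / 2)))
      \<longlonglongrightarrow> - (5 / 2) / ?c * (sqrt (4 / 5) * (- 1 / (2 * sqrt pi)) * 1)"
    by (intro tendsto_intros)
  also have "- (5 / 2) / ?c * (sqrt (4 / 5) * (- 1 / (2 * sqrt pi)) * 1) = 1"
  proof -
    have "sqrt 5 * sqrt 5 = 5" by simp
    then show ?thesis by (simp add: real_sqrt_divide field_simps)
  qed
  finally have "(\<lambda>n. - (5 / 2) / ?c * (q (Suc n) * r (Suc n) * (real n / real (Suc n)) powr (3 / 2)))
      \<longlonglongrightarrow> 1" .
  moreover have "\<forall>\<^sub>F n in sequentially.
      - (5 / 2) / ?c * (q (Suc n) * r (Suc n) * (real n / real (Suc n)) powr (3 / 2)) =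
      real (num_rooted n) / (?c * 5 ^ n * real n powr (- (3 / 2)))"
    using eventually_ge_at_top[of 1]
  proof eventually_elim
    case (elim n)
    have a: "real (num_rooted n) = - (1 / 2) * (q (Suc n) * (5 ^ Suc n * sqrt_coeff (Suc n)))"
      unfolding num_rooted_sqrt_coeff[OF elim] q_def using sqrt_coeff_nonzero[of "Suc n"] by simp
    have p: "r (Suc n) * (real n / real (Suc n)) powr (3 / 2) = sqrt_coeff (Suc n) * real n powr (3 / 2)"
      using elim by (simp add: r_def powr_divide)
    have "- (5 / 2) / ?c * (q (Suc n) * r (Suc n) * (real n / real (Suc n)) powr (3 / 2)) =
        - (5 / 2) / ?c * (q (Suc n) * (sqrt_coeff (Suc n) * real n powr (3 / 2)))"
      by (simp only: mult.assoc p)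
    also have "\<dots> = real (num_rooted n) / (?c * 5 ^ n * real n powr (- (3 / 2)))"
      unfolding a powr_minus by (simp add: divide_simps)
    finally show ?case .
  qed
  ultimately show "(\<lambda>n. real (num_rooted n) / (?c * 5 ^ n * real n powr (- (3 / 2)))) \<longlonglongrightarrow> 1"
    by (rule Lim_transform_eventually)
qed

section \<open>Initial coefficients\<close>

lemma code_sum_small:
  fixes s :: "'a :: comm_ring_1"
  shows "code_sum s (Suc 0) = s" "code_sum s 2 = s + 2 * s\<^sup>2"
    "code_sum s 3 = s + 4 * s\<^sup>2 + 5 * s ^ 3"
proof -
  show 1: "code_sum s (Suc 0) = s" by (simp add: code_sum_Suc)
  have 2: "code_sum s (Suc (Suc 0)) = s + 2 * s\<^sup>2"
    by (simp add: code_sum_Suc[of s "Suc 0"] 1 power2_eq_square algebra_simps)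
  then show "code_sum s 2 = s + 2 * s\<^sup>2" by (simp add: numeral_2_eq_2)
  have "code_sum s (Suc (Suc (Suc 0))) = s + 4 * s\<^sup>2 + 5 * s ^ 3"
    by (simp add: code_sum_Suc[of s "Suc (Suc 0)"] 1 2 power2_eq_square power3_eq_cube algebra_simps)
  then show "code_sum s 3 = s + 4 * s\<^sup>2 + 5 * s ^ 3" by (simp add: numeral_3_eq_3)
qed

lemma num_rooted_Suc:
  "num_rooted (Suc n) = (if n = 0 then 0 else num_rooted n) +
     (\<Sum>k\<le>n. num_rooted k * num_rooted (n - k))"
  by (simp add: num_rooted_code_sum code_sum_Suc)

lemma num_rooted_small:
  "num_rooted 0 = 1" "num_rooted 1 = 1" "num_rooted 2 = 3" "num_rooted 3 = 10"
  "num_rooted 4 = 36" "num_rooted 5 = 137" "num_rooted 6 = 543"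
proof -
  show 0: "num_rooted 0 = 1" by (simp add: num_rooted_code_sum)
  show 1: "num_rooted 1 = 1" using num_rooted_Suc[of 0] by (simp add: 0)
  show 2: "num_rooted 2 = 3"
    using num_rooted_Suc[of 1] 0 1 by (simp add: numeral_2_eq_2)
  show 3: "num_rooted 3 = 10"
    using num_rooted_Suc[of 2] 0 1 2 by (simp add: eval_nat_numeral)
  show 4: "num_rooted 4 = 36"
    using num_rooted_Suc[of 3] 0 1 2 3 by (simp add: eval_nat_numeral)
  show 5: "num_rooted 5 = 137"
    using num_rooted_Suc[of 4] 0 1 2 3 4 by (simp add: eval_nat_numeral)
  show 6: "num_rooted 6 = 543"
    using num_rooted_Suc[of 5] 0 1 2 3 4 5 by (simp add: eval_nat_numeral)
qed

lemma rooted_gf_cutoff: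
  "fps_cutoff 7 rooted_gf = 1 + fps_X + 3 * fps_X ^ 2 + 10 * fps_X ^ 3 + 36 * fps_X ^ 4
     + 137 * fps_X ^ 5 + 543 * fps_X ^ 6"
proof (rule fps_ext)
  fix n :: nat
  have "n = 0 \<or> n = 1 \<or> n = 2 \<or> n = 3 \<or> n = 4 \<or> n = 5 \<or> n = 6 \<or> n \<ge> 7" by linarith
  then show "fps_nth (fps_cutoff 7 rooted_gf) n = fps_nth (1 + fps_X + 3 * fps_X ^ 2
      + 10 * fps_X ^ 3 + 36 * fps_X ^ 4 + 137 * fps_X ^ 5 + 543 * fps_X ^ 6) n"
    by (elim disjE)
      (simp_all add: rooted_gf_def num_rooted_small num_rooted_small(2)[simplified] numeral_fps_const)
qed

lemma rooted_edges_gf_cutoff: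
  "fps_cutoff 4 rooted_edges_gf = 1 + fps_const fls_X * fps_X
     + (fps_const fls_X + 2 * fps_const fls_X ^ 2) * fps_X ^ 2
     + (fps_const fls_X + 4 * fps_const fls_X ^ 2 + 5 * fps_const fls_X ^ 3) * fps_X ^ 3"
proof (rule fps_ext)
  fix n :: nat
  have "n = 0 \<or> n = 1 \<or> n = 2 \<or> n = 3 \<or> n \<ge> 4" by linarith
  then show "fps_nth (fps_cutoff 4 rooted_edges_gf) n = fps_nth (1 + fps_const fls_X * fps_X
     + (fps_const fls_X + 2 * fps_const fls_X ^ 2) * fps_X ^ 2
     + (fps_const fls_X + 4 * fps_const fls_X ^ 2 + 5 * fps_const fls_X ^ 3) * fps_X ^ 3) n"
    by (elim disjE)
      (simp_all add: rooted_edges_gf_code_sum code_sum_small numeral_fps_const fps_const_power)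
qed

theorem theorem1:
  fixes a :: "nat \<Rightarrow> nat" and b :: "nat \<Rightarrow> nat \<Rightarrow> nat" and c :: "nat \<Rightarrow> real"
    and f :: "real fps" and h s t :: "real fls fps"
  defines "a \<equiv> num_rooted" and "b \<equiv> num_rooted_edges" and "c \<equiv> unrooted_mass"
    and "f \<equiv> rooted_gf" and "h \<equiv> rooted_edges_gf"
    and "s \<equiv> fps_const fls_X" and "t \<equiv> fps_X"
  shows
    "f = (1 - fps_X - fps_sqrt (1 - 6 * fps_X + 5 * fps_X ^ 2)) / (2 * fps_X) \<and>
     fps_cutoff 7 f = 1 + fps_X + 3 * fps_X ^ 2 + 10 * fps_X ^ 3 + 36 * fps_X ^ 4
       + 137 * fps_X ^ 5 + 543 * fps_X ^ 6 \<and>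
     a 0 = 1 \<and> a 1 = 1 \<and>
     (\<forall>n\<ge>1. a (n + 1) = a n + (\<Sum>k=0..n. a k * a (n - k))) \<and>
     (\<lambda>n. real (a n)) \<sim>[sequentially]
       (\<lambda>n. 1 / 2 * sqrt (5 / pi) * 5 ^ n * real n powr (- (3 / 2))) \<and>
     h = (1 - t - fps_sqrt (1 - (2 + 4 * s) * t + (1 + 4 * s) * t ^ 2)) / (2 * s * t) \<and>
     fps_cutoff 4 h =
       1 + s * t + (s + 2 * s ^ 2) * t ^ 2 + (s + 4 * s ^ 2 + 5 * s ^ 3) * t ^ 3 \<and>
     (\<forall>m\<ge>1. \<forall>n\<ge>1.
        b m n = ((n - 1) choose (m - 1)) * catalan m \<and>
        real (b m n) =
          real ((n - 1) choose (m - 1)) * (1 / real (m + 1)) * real ((2 * m) choose m)) \<and>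
     (\<forall>n\<ge>1. c n = (\<Sum>m=1..n. real (b m n) / real m))"
proof (intro conjI)
  have "fps_const (1 :: real) = 1" by simp
  then show "f = (1 - fps_X - fps_sqrt (1 - 6 * fps_X + 5 * fps_X ^ 2)) / (2 * fps_X)"
    unfolding f_def rooted_gf_code_sum using code_sum_closed_form[of "1 :: real"] by simp
  show "fps_cutoff 7 f = 1 + fps_X + 3 * fps_X ^ 2 + 10 * fps_X ^ 3 + 36 * fps_X ^ 4
      + 137 * fps_X ^ 5 + 543 * fps_X ^ 6"
    unfolding f_def by (rule rooted_gf_cutoff)
  show "a 0 = 1" "a 1 = 1" unfolding a_def by (rule num_rooted_small)+
  show "\<forall>n\<ge>1. a (n + 1) = a n + (\<Sum>k=0..n. a k * a (n - k))"
    unfolding a_def by (simp add: num_rooted_Suc atLeast0AtMost)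
  show "(\<lambda>n. real (a n)) \<sim>[sequentially]
      (\<lambda>n. 1 / 2 * sqrt (5 / pi) * 5 ^ n * real n powr (- (3 / 2)))"
    unfolding a_def by (rule num_rooted_asymptotic)
  show "h = (1 - t - fps_sqrt (1 - (2 + 4 * s) * t + (1 + 4 * s) * t ^ 2)) / (2 * s * t)"
    unfolding h_def s_def t_def rooted_edges_gf_code_sum by (rule code_sum_closed_form) simp
  show "fps_cutoff 4 h =
      1 + s * t + (s + 2 * s ^ 2) * t ^ 2 + (s + 4 * s ^ 2 + 5 * s ^ 3) * t ^ 3"
    unfolding h_def s_def t_def by (rule rooted_edges_gf_cutoff)
  show "\<forall>m\<ge>1. \<forall>n\<ge>1. b m n = ((n - 1) choose (m - 1)) * catalan m \<and>
      real (b m n) = real ((n - 1) choose (m - 1)) * (1 / real (m + 1)) * real ((2 * m) choose m)"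
    unfolding b_def using num_rooted_edges_closed_form catalan_closed_form by simp
  show "\<forall>n\<ge>1. c n = (\<Sum>m=1..n. real (b m n) / real m)"
    unfolding b_def c_def using unrooted_mass_sum by blast
qed

end
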